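(* Let $p$ be a prime and let $G$ be a finite purely non-abelian $p$-group. Let $\lambda: Z(G)\to G/G'$ be the homomorphism $\lambda(x)=xG'$, let $p^b=\exp(G/G')$, let $\mathcal{R}=\{x\in Z(G) : |x|\le p^b\}$, let $p^{n_1}=\exp(\mathcal{R})$, and let $p^c=\exp(Z(G)\cap G')$. Then the central automorphisms of $G$ commute with each other (i.e. $\mathrm{Aut}_c(G)$ is abelian) if and only if at least one of the following holds: (1) $\lambda(\mathcal{R})\subseteq \left(G/G'\right)^{p^{n_1}}$; or (2) there is an integer $k$ with $c\le k<n_1$ such that $\lambda(\mathcal{R})=\left(G/G'\right)^{p^{k}}$, and $\mathcal{R}/(Z(G)\cap G')$ is cyclic.
   Context: $Z(G)$ is the center and $G'$ the commutator subgroup of $G$; $|x|$ is the order of $x$; $\exp$ denotes the exponent of a group. A group is purely non-abelian (PN) if it has no nontrivial abelian direct factor. An automorphism $\sigma$ of $G$ is central if $g^{-1}\sigma(g)\in Z(G)$ for all $g\in G$; $\mathrm{Aut}_c(G)$ is the group of central automorphisms. For an abelian group $B$ written multiplicatively, $B^{p^k}=\{x^{p^k}: x\in B\}$. In (2), since $c<n_1$, the subgroup $Z(G)\cap G'=\ker\lambda$ is contained in $\mathcal{R}$, so the quotient makes sense. *)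

theory Defs
  imports "HOL-Algebra.Algebra"
begin

definition group_center :: "('a, 'b) monoid_scheme \<Rightarrow> 'a set" where
  "group_center G =
     {z \<in> carrier G. \<forall>g \<in> carrier G. z \<otimes>\<^bsub>G\<^esub> g = g \<otimes>\<^bsub>G\<^esub> z}"

text \<open>The value is junk if no positive exponent exists, which does not occur for finite groups.\<close>

definition group_exponent :: "('a, 'b) monoid_scheme \<Rightarrow> nat" where
  "group_exponent G = (LEAST n. n > 0 \<and> (\<forall>x \<in> carrier G. x [^]\<^bsub>G\<^esub> n = \<one>\<^bsub>G\<^esub>))"

definition nth_powers :: "('a, 'b) monoid_scheme \<Rightarrow> nat \<Rightarrow> 'a set" where
  "nth_powers G n = (\<lambda>x. x [^]\<^bsub>G\<^esub> n) ` carrier G"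

definition direct_factor :: "'a set \<Rightarrow> ('a, 'b) monoid_scheme \<Rightarrow> bool" where
  "direct_factor H G \<longleftrightarrow>
     H \<lhd> G \<and> (\<exists>K. K \<lhd> G \<and> H \<inter> K = {\<one>\<^bsub>G\<^esub>} \<and> H <#>\<^bsub>G\<^esub> K = carrier G)"

definition purely_nonabelian :: "('a, 'b) monoid_scheme \<Rightarrow> bool" where
  "purely_nonabelian G \<longleftrightarrow>
     \<not> (\<exists>H. direct_factor H G \<and> H \<noteq> {\<one>\<^bsub>G\<^esub>} \<and> comm_group (G\<lparr>carrier := H\<rparr>))"

definition central_auto :: "('a, 'b) monoid_scheme \<Rightarrow> ('a \<Rightarrow> 'a) set" where
  "central_auto G =
     {\<sigma> \<in> auto G. \<forall>g \<in> carrier G. inv\<^bsub>G\<^esub> g \<otimes>\<^bsub>G\<^esub> \<sigma> g \<in> group_center G}"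

definition CentralAutoGroup :: "('a, 'b) monoid_scheme \<Rightarrow> ('a \<Rightarrow> 'a) monoid" where
  "CentralAutoGroup G = AutoGroup G\<lparr>carrier := central_auto G\<rparr>"

end

theory Submission
  imports Defs "HOL-Number_Theory.Cong"
begin

text \<open>
A central automorphism has the form \<open>\<sigma> x = x \<otimes> f x\<close> with a homomorphism \<open>f\<close> from \<open>G\<close> to its centre
\<open>Z\<close>. When \<open>G\<close> is purely non-abelian, conversely every such \<open>f\<close> occurs
(\<open>central_endomorphism_bij\<close>, the theorem of Adney and Yen): by Fitting's decomposition a nontrivial
kernel of \<open>\<sigma>\<close> would produce an abelian direct factor. Two central automorphisms commute if and only
if \<open>f (g x) = g (f x)\<close> for all \<open>x\<close>, and homomorphisms to \<open>Z\<close> factor through the abelianisation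
\<open>A = G/G'\<close>. What remains is a question about finite abelian \<open>p\<close>-groups: when does
\<open>f \<circ> lam \<circ> g = g \<circ> lam \<circ> f\<close> hold for all homomorphisms \<open>f\<close> and \<open>g\<close> from \<open>A\<close> to \<open>Z\<close>, with \<open>lam\<close> the natural map
from \<open>Z\<close> to \<open>A\<close>?

Homomorphisms from \<open>A\<close> take values in the subgroup \<open>R\<close> of elements of order at most \<open>p ^ b\<close>. If \<open>lam ` R\<close>
consists of \<open>p ^ n1\<close>-th powers, all composites vanish (\<open>homs_commute_if_high_powers\<close>). If \<open>lam ` R\<close>
is the group of \<open>p ^ k\<close>-th powers and cyclic, then every homomorphism acts on it
through one integer, and integers commute (\<open>homs_commute_if_cyclic\<close>).

For the converse (\<open>homs_commute_imp\<close>) the commutation relation is tested on homomorphisms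
\<open>x \<mapsto> r [^] \<psi> x\<close> with \<open>\<psi>\<close> a character of \<open>A\<close> modulo \<open>p ^ b\<close> or \<open>p ^ n1\<close>. Two consequences of the extension theorem
for characters (\<open>character_extend\<close>) suffice: an element of maximal order is split
off by a character (\<open>character_with_value_at\<close>), and an element on which all characters modulo \<open>n\<close> vanish
is an \<open>n\<close>-th power (\<open>nth_power_if_characters_vanish\<close>).
\<close>

section \<open>Characters modulo an integer\<close>

text \<open>Characters modulo \<open>m\<close> take values in the integers, read modulo \<open>m\<close>, rather than in a model of
\<open>\<int>/m\<int>\<close>: the map \<open>x \<mapsto> z [^] \<psi> x\<close> is then a homomorphism whenever \<open>z [^] m = \<one>\<close>, without any
conversion of exponents. The subset \<open>H\<close> makes partially defined characters available, as is
needed to extend them step by step.\<close>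
definition character_on :: "('a, 'b) monoid_scheme \<Rightarrow> 'a set \<Rightarrow> nat \<Rightarrow> ('a \<Rightarrow> int) \<Rightarrow> bool" where
  "character_on A H m \<psi> \<longleftrightarrow>
     (\<forall>x\<in>H. \<forall>y\<in>H. [\<psi> (x \<otimes>\<^bsub>A\<^esub> y) = \<psi> x + \<psi> y] (mod int m))"

lemma character_onD:
  "character_on A H m \<psi> \<Longrightarrow> x \<in> H \<Longrightarrow> y \<in> H \<Longrightarrow> [\<psi> (x \<otimes>\<^bsub>A\<^esub> y) = \<psi> x + \<psi> y] (mod int m)"
  by (simp add: character_on_def)

context group
begin

lemma character_on_one:
  assumes "character_on G H m \<psi>" "subgroup H G"
  shows "[\<psi> \<one> = 0] (mod int m)"
proof -
  have "\<one> \<in> H" using assms(2) by (rule subgroup.one_closed)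
  then have "[\<psi> (\<one> \<otimes> \<one>) = \<psi> \<one> + \<psi> \<one>] (mod int m)"
    by (intro character_onD[OF assms(1)])
  then show ?thesis by (simp add: cong_iff_dvd_diff)
qed

lemma character_on_nat_pow:
  assumes "character_on G H m \<psi>" "subgroup H G" "x \<in> H"
  shows "[\<psi> (x [^] (n::nat)) = int n * \<psi> x] (mod int m)"
proof (induction n)
  case 0
  show ?case using character_on_one[OF assms(1,2)] by simp
next
  case (Suc n)
  have "x [^] n \<in> H"
    using assms(2,3) subgroup_int_pow_closed[of H x "int n"] by (simp add: int_pow_int)
  then have "[\<psi> (x [^] n \<otimes> x) = \<psi> (x [^] n) + \<psi> x] (mod int m)"
    by (intro character_onD[OF assms(1)] assms(3))
  also have "[\<psi> (x [^] n) + \<psi> x = int n * \<psi> x + \<psi> x] (mod int m)"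
    using Suc.IH by (intro cong_add) auto
  finally show ?case by (simp add: algebra_simps)
qed

lemma character_on_int_pow:
  assumes "character_on G H m \<psi>" "subgroup H G" "x \<in> H"
  shows "[\<psi> (x [^] (i::int)) = i * \<psi> x] (mod int m)"
proof (cases i rule: int_cases2)
  case (nonneg n)
  then show ?thesis using character_on_nat_pow[OF assms] by (simp add: int_pow_int)
next
  case (nonpos n)
  have x: "x \<in> carrier G" using subgroup.mem_carrier[OF assms(2,3)] .
  have c: "x [^] i \<in> H" "x [^] n \<in> H"
    using assms(2,3) subgroup_int_pow_closed[of H x] by (simp, metis int_pow_int)
  have "x [^] i \<otimes> x [^] n = \<one>"
    using x nonpos by (simp add: int_pow_neg_int)
  then have "[\<psi> \<one> = \<psi> (x [^] i) + \<psi> (x [^] n)] (mod int m)"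
    using character_onD[OF assms(1) c] by simp
  with character_on_one[OF assms(1,2)] have "[\<psi> (x [^] i) + \<psi> (x [^] n) = 0] (mod int m)"
    using cong_trans cong_sym by blast
  moreover have "[\<psi> (x [^] n) = int n * \<psi> x] (mod int m)"
    by (rule character_on_nat_pow[OF assms])
  ultimately have "int m dvd \<psi> (x [^] i) + \<psi> (x [^] n) - (\<psi> (x [^] n) - int n * \<psi> x)"
    unfolding cong_iff_dvd_diff by (metis diff_0_right dvd_diff)
  then show ?thesis using nonpos by (simp add: cong_iff_dvd_diff algebra_simps)
qed

lemma int_pow_cong:
  assumes "z \<in> carrier G" "z [^] (m::nat) = \<one>" "[i = j] (mod int m)"
  shows "z [^] (i::int) = z [^] j"
proof -
  have "ord z dvd m" using assms pow_eq_id by blast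
  then have "int (ord z) dvd i - j"
    using assms(3) by (meson cong_iff_dvd_diff dvd_trans of_nat_dvd_iff)
  then show ?thesis using assms(1) int_pow_eq dvd_diff_commute by blast
qed

text \<open>How characters are used: together with an element of order dividing \<open>m\<close> they produce all the
homomorphisms on which commutation is tested.\<close>
lemma character_hom:
  assumes "character_on A (carrier A) m \<psi>" "z \<in> carrier G" "z [^] (m::nat) = \<one>"
  shows "(\<lambda>x. z [^] \<psi> x) \<in> hom A G"
proof -
  have "z [^] \<psi> (x \<otimes>\<^bsub>A\<^esub> y) = z [^] \<psi> x \<otimes> z [^] \<psi> y" if "x \<in> carrier A" "y \<in> carrier A" for x y
    using int_pow_cong[OF assms(2,3) character_onD[OF assms(1) that]] assms(2)
    by (simp add: int_pow_mult)
  then show ?thesis using assms(2) by (auto simp: hom_def)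
qed

end

context comm_group
begin

text \<open>Let \<open>d\<close> be the order of \<open>x\<close> modulo \<open>H\<close>. An extension to \<open>\<langle>H, x\<rangle>\<close> has to send \<open>x\<close> to a \<open>d\<close>-th part
of \<open>\<phi> (x [^] d)\<close>. It exists because \<open>d\<close> divides \<open>m\<close> and \<open>m div d\<close> annihilates \<open>\<phi> (x [^] d)\<close> modulo \<open>m\<close>.\<close>
lemma character_extend_step:
  assumes m: "m > 0" "\<And>y. y \<in> carrier G \<Longrightarrow> y [^] (m::nat) = \<one>"
    and H: "subgroup H G" and \<phi>: "character_on G H m \<phi>"
    and x: "x \<in> carrier G" "x \<notin> H"
  shows "\<exists>H' \<psi>. subgroup H' G \<and> H \<subset> H' \<and> character_on G H' m \<psi> \<and>
           (\<forall>y\<in>H. [\<psi> y = \<phi> y] (mod int m))"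
proof -
  have Hc: "h \<in> carrier G" if "h \<in> H" for h using subgroup.mem_carrier[OF H that] .
  \<comment> \<open>The order \<open>d\<close> of \<open>x\<close> modulo \<open>H\<close>.\<close>
  define P where "P n \<longleftrightarrow> n > 0 \<and> x [^] (n::nat) \<in> H" for n
  define d where "d = (LEAST n. P n)"
  have "P m" using m x H by (simp add: P_def subgroup.one_closed)
  then have Pd: "P d" unfolding d_def by (rule LeastI)
  have min: "d \<le> n" if "P n" for n using that unfolding d_def by (rule Least_le)
  have d: "d > 0" "x [^] d \<in> H" using Pd by (auto simp: P_def)
  have dint: "x [^] int d \<in> H" using d by (simp add: int_pow_int)
  have dvd: "int d dvd i" if "x [^] (i::int) \<in> H" for i
  proof (rule ccontr)
    assume nd: "\<not> int d dvd i"
    define r where "r = i mod int d"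
    have "r \<ge> 0" "r < int d" using d(1) by (simp_all add: r_def)
    moreover have "r \<noteq> 0" using nd by (simp add: r_def dvd_eq_mod_eq_0)
    ultimately have "r > 0" by simp
    have "i = int d * (i div int d) + r" by (simp add: r_def)
    then have "x [^] i = (x [^] int d) [^] (i div int d) \<otimes> x [^] r"
      using x by (metis int_pow_mult int_pow_pow)
    then have "x [^] r = inv ((x [^] int d) [^] (i div int d)) \<otimes> x [^] i"
      using x by (metis int_pow_closed inv_solve_left)
    also have "\<dots> \<in> H"
      using H that dint by (meson subgroup.m_closed subgroup.m_inv_closed subgroup_int_pow_closed)
    finally have "x [^] nat r \<in> H" using \<open>r > 0\<close> by (simp add: pow_nat)
    then have "d \<le> nat r" using \<open>r > 0\<close> by (intro min) (simp add: P_def)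
    then show False using \<open>r < int d\<close> \<open>r > 0\<close> by linarith
  qed
  have "int d dvd int m"
    using m x H by (intro dvd) (simp add: int_pow_int subgroup.one_closed)
  then obtain q where q: "m = d * q" by (auto simp: of_nat_dvd_iff)
  \<comment> \<open>The required \<open>d\<close>-th part of the value at \<open>x [^] d\<close>.\<close>
  obtain e where e: "\<phi> (x [^] d) = int d * e"
  proof -
    have "[\<phi> ((x [^] d) [^] q) = int q * \<phi> (x [^] d)] (mod int m)"
      by (rule character_on_nat_pow[OF \<phi> H d(2)])
    moreover have "(x [^] d) [^] q = \<one>"
      using m(2)[OF x(1)] x(1) by (simp add: nat_pow_pow q)
    ultimately have "[int q * \<phi> (x [^] d) = 0] (mod int m)"
      using character_on_one[OF \<phi> H] by (metis cong_sym cong_trans)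
    then have "int q * int d dvd int q * \<phi> (x [^] d)"
      by (simp add: cong_0_iff q mult.commute)
    moreover have "q > 0" using m q by (cases q) auto
    ultimately show ?thesis using that by (auto simp: dvd_def)
  qed
  \<comment> \<open>Two presentations of one element of \<open>\<langle>H, x\<rangle>\<close> differ by a power of \<open>x [^] d\<close>.\<close>
  have wd: "[\<phi> h + e * i = \<phi> h' + e * j] (mod int m)"
    if hh: "h \<in> H" "h' \<in> H" "h \<otimes> x [^] i = h' \<otimes> x [^] j" for h h' and i j :: int
  proof -
    have "x [^] (i - j) = x [^] i \<otimes> inv (x [^] j)" using x by (simp add: int_pow_diff)
    also have "\<dots> = inv h \<otimes> h'"
      using hh(3) Hc[OF hh(1)] Hc[OF hh(2)] x
      by (metis (no_types, lifting) int_pow_closed inv_closed inv_solve_left m_assoc m_closed r_inv r_one inv_solve_right)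
    finally have eq: "x [^] (i - j) = inv h \<otimes> h'" .
    then have "x [^] (i - j) \<in> H"
      using H hh by (simp add: subgroup.m_closed subgroup.m_inv_closed)
    then obtain s where s: "i - j = int d * s" using dvd by (auto simp: dvd_def)
    have "h' = h \<otimes> (x [^] int d) [^] s"
      using eq s Hc[OF hh(1)] Hc[OF hh(2)] x by (simp add: int_pow_pow inv_solve_left)
    moreover have "(x [^] int d) [^] s \<in> H" using H dint subgroup_int_pow_closed by blast
    ultimately have "[\<phi> h' = \<phi> h + \<phi> ((x [^] int d) [^] s)] (mod int m)"
      using character_onD[OF \<phi> hh(1)] by simp
    also have "[\<phi> h + \<phi> ((x [^] int d) [^] s) = \<phi> h + s * \<phi> (x [^] int d)] (mod int m)"
      by (intro cong_add cong_refl character_on_int_pow[OF \<phi> H dint])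
    also have "\<phi> h + s * \<phi> (x [^] int d) = \<phi> h + e * (i - j)"
      using e s by (simp add: int_pow_int)
    finally have "[\<phi> h' + e * j = \<phi> h + e * (i - j) + e * j] (mod int m)"
      by (intro cong_add cong_refl)
    then show ?thesis by (simp add: algebra_simps cong_sym)
  qed
  define H' where "H' = {h \<otimes> x [^] i | h i. h \<in> H \<and> (i::int) \<in> UNIV}"
  define \<psi> where "\<psi> y = (let w = SOME w. fst w \<in> H \<and> y = fst w \<otimes> x [^] (snd w :: int)
                           in \<phi> (fst w) + e * snd w)" for y
  have \<psi>: "[\<psi> (h \<otimes> x [^] i) = \<phi> h + e * i] (mod int m)" if "h \<in> H" for h and i :: int
  proof -
    define w where "w = (SOME w. fst w \<in> H \<and> h \<otimes> x [^] i = fst w \<otimes> x [^] (snd w :: int))"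
    have "fst w \<in> H \<and> h \<otimes> x [^] i = fst w \<otimes> x [^] (snd w :: int)"
      unfolding w_def by (rule someI[where x = "(h, i)"]) (use that in simp)
    then have "[\<phi> (fst w) + e * snd w = \<phi> h + e * i] (mod int m)"
      by (intro wd) (use that in auto)
    then show ?thesis by (simp add: \<psi>_def Let_def w_def)
  qed
  have prod: "(h \<otimes> x [^] i) \<otimes> (h' \<otimes> x [^] j) = (h \<otimes> h') \<otimes> x [^] (i + j)"
    if "h \<in> H" "h' \<in> H" for h h' and i j :: int
    using Hc[OF that(1)] Hc[OF that(2)] x by (simp add: int_pow_mult m_ac)
  have "subgroup H' G"
  proof (rule subgroupI)
    show "H' \<subseteq> carrier G" using Hc x by (auto simp: H'_def)
    show "H' \<noteq> {}" using H subgroup.one_closed by (fastforce simp: H'_def)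
    fix a assume "a \<in> H'"
    then obtain h and i :: int where a: "h \<in> H" "a = h \<otimes> x [^] i" by (auto simp: H'_def)
    have "inv a = inv h \<otimes> x [^] (- i)"
      using a Hc[OF a(1)] x by (simp add: inv_mult int_pow_neg)
    then show "inv a \<in> H'" using a H subgroup.m_inv_closed by (fastforce simp: H'_def)
    fix b assume "b \<in> H'"
    then obtain h' and j :: int where b: "h' \<in> H" "b = h' \<otimes> x [^] j" by (auto simp: H'_def)
    show "a \<otimes> b \<in> H'"
      using a b prod[OF a(1) b(1)] subgroup.m_closed[OF H a(1) b(1)] by (auto simp: H'_def)
  qed
  moreover have "H \<subset> H'"
  proof -
    have "h \<in> H'" if "h \<in> H" for h
    proof -
      have "h = h \<otimes> x [^] (0::int)" using Hc[OF that] by simp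
      then show ?thesis using that unfolding H'_def by blast
    qed
    moreover have "x = \<one> \<otimes> x [^] (1::int)" using x by simp
    then have "x \<in> H'" using subgroup.one_closed[OF H] unfolding H'_def by blast
    ultimately show ?thesis using x by blast
  qed
  moreover have "character_on G H' m \<psi>"
    unfolding character_on_def
  proof (intro ballI)
    fix a b assume "a \<in> H'" "b \<in> H'"
    then obtain h h' and i j :: int
      where a: "h \<in> H" "a = h \<otimes> x [^] i" and b: "h' \<in> H" "b = h' \<otimes> x [^] j"
      by (auto simp: H'_def)
    have "[\<psi> (a \<otimes> b) = \<phi> (h \<otimes> h') + e * (i + j)] (mod int m)"
      using \<psi> prod a b subgroup.m_closed[OF H a(1) b(1)] by simp
    also have "[\<phi> (h \<otimes> h') + e * (i + j) = (\<phi> h + \<phi> h') + e * (i + j)] (mod int m)"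
      by (intro cong_add cong_refl character_onD[OF \<phi>] a b)
    also have "(\<phi> h + \<phi> h') + e * (i + j) = (\<phi> h + e * i) + (\<phi> h' + e * j)"
      by (simp add: algebra_simps)
    also have "[\<dots> = \<psi> a + \<psi> b] (mod int m)"
      using \<psi> a b by (intro cong_add) (auto intro: cong_sym)
    finally show "[\<psi> (a \<otimes> b) = \<psi> a + \<psi> b] (mod int m)" .
  qed
  moreover have "[\<psi> y = \<phi> y] (mod int m)" if "y \<in> H" for y
    using \<psi>[OF that, of 0] Hc[OF that] by simp
  ultimately show ?thesis by blast
qed

text \<open>Injectivity of \<open>\<int>/m\<int>\<close> among abelian groups of exponent dividing \<open>m\<close>. It takes the place of the
structure theorem for finite abelian groups: all further information about such groups is
obtained from characters extended from cyclic subgroups.\<close>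
theorem character_extend:
  assumes m: "m > 0" "\<And>y. y \<in> carrier G \<Longrightarrow> y [^] (m::nat) = \<one>"
    and fin: "finite (carrier G)"
    and H: "subgroup H G" and \<phi>: "character_on G H m \<phi>"
  shows "\<exists>\<psi>. character_on G (carrier G) m \<psi> \<and> (\<forall>y\<in>H. [\<psi> y = \<phi> y] (mod int m))"
  using H \<phi>
proof (induction "card (carrier G - H)" arbitrary: H \<phi> rule: less_induct)
  case less
  show ?case
  proof (cases "H = carrier G")
    case True
    then show ?thesis using less.prems by (intro exI[of _ \<phi>]) simp
  next
    case False
    then obtain x where "x \<in> carrier G" "x \<notin> H"
      using less.prems(1) subgroup.subset by blast
    from character_extend_step[OF m less.prems this]
    obtain H' \<psi> where H': "subgroup H' G" "H \<subset> H'" "character_on G H' m \<psi>"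
      and \<psi>: "\<forall>y\<in>H. [\<psi> y = \<phi> y] (mod int m)" by blast
    have "carrier G - H' \<subset> carrier G - H"
      using H' subgroup.subset[OF H'(1)] by blast
    then have "card (carrier G - H') < card (carrier G - H)"
      using fin by (intro psubset_card_mono) auto
    from less.hyps[OF this H'(1,3)] obtain \<chi>
      where \<chi>: "character_on G (carrier G) m \<chi>" "\<forall>y\<in>H'. [\<chi> y = \<psi> y] (mod int m)" by blast
    then have "\<forall>y\<in>H. [\<chi> y = \<phi> y] (mod int m)"
      using \<psi> H'(2) by (meson cong_trans psubsetD)
    with \<chi>(1) show ?thesis by blast
  qed
qed

lemma character_with_value_at:
  assumes m: "m > 0" "\<And>y. y \<in> carrier G \<Longrightarrow> y [^] (m::nat) = \<one>"
    and fin: "finite (carrier G)" and x: "x \<in> carrier G" and k: "int m dvd int (ord x) * k"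
  shows "\<exists>\<psi>. character_on G (carrier G) m \<psi> \<and> [\<psi> x = k] (mod int m)"
proof -
  define H where "H = range (\<lambda>i::int. x [^] i)"
  have H: "subgroup H G"
  proof -
    have "H = generate G {x}" unfolding H_def generate_pow[OF x] by auto
    then show ?thesis using generate_is_subgroup[of "{x}"] x by simp
  qed
  define \<phi> where "\<phi> y = k * (SOME i. y = x [^] (i::int))" for y
  have \<phi>: "[\<phi> (x [^] i) = k * i] (mod int m)" for i :: int
  proof -
    define j where "j = (SOME j. x [^] i = x [^] (j::int))"
    have "x [^] i = x [^] j" unfolding j_def by (rule someI) simp
    then have "int (ord x) dvd j - i" using x int_pow_eq by (metis dvd_diff_commute)
    then have "int m dvd k * (j - i)" using k by (metis dvd_trans mult.commute mult_dvd_mono dvd_refl)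
    then show ?thesis by (simp add: \<phi>_def j_def cong_iff_dvd_diff algebra_simps)
  qed
  have "character_on G H m \<phi>"
    unfolding character_on_def H_def
  proof clarify
    fix i j :: int
    have "[\<phi> (x [^] i \<otimes> x [^] j) = k * (i + j)] (mod int m)"
      using \<phi> x by (metis int_pow_mult)
    also have "k * (i + j) = k * i + k * j" by (simp add: algebra_simps)
    also have "[\<dots> = \<phi> (x [^] i) + \<phi> (x [^] j)] (mod int m)"
      by (intro cong_add cong_sym[OF \<phi>])
    finally show "[\<phi> (x [^] i \<otimes> x [^] j) = \<phi> (x [^] i) + \<phi> (x [^] j)] (mod int m)" .
  qed
  from character_extend[OF m fin H this] obtain \<psi>
    where \<psi>: "character_on G (carrier G) m \<psi>" "\<forall>y\<in>H. [\<psi> y = \<phi> y] (mod int m)" by blast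
  have "x [^] (1::int) \<in> H" unfolding H_def by blast
  then have "[\<psi> x = \<phi> x] (mod int m)" using \<psi>(2) x by simp
  also have "[\<phi> x = k] (mod int m)" using \<phi>[of 1] x by simp
  finally show ?thesis using \<psi>(1) by blast
qed

lemma nth_powers_subgroup: "subgroup (nth_powers G n) G"
proof (rule subgroupI)
  show "nth_powers G n \<subseteq> carrier G" by (auto simp: nth_powers_def)
  show "nth_powers G n \<noteq> {}" by (auto simp: nth_powers_def)
  fix a assume "a \<in> nth_powers G n"
  then obtain x where x: "x \<in> carrier G" "a = x [^] n" by (auto simp: nth_powers_def)
  then have "inv a = (inv x) [^] n" by (simp add: nat_pow_inv)
  then show "inv a \<in> nth_powers G n" using x by (auto simp: nth_powers_def)
  fix b assume "b \<in> nth_powers G n"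
  then obtain y where y: "y \<in> carrier G" "b = y [^] n" by (auto simp: nth_powers_def)
  then have "a \<otimes> b = (x \<otimes> y) [^] n" using x by (simp add: nat_pow_distrib)
  then show "a \<otimes> b \<in> nth_powers G n" using x y by (auto simp: nth_powers_def)
qed

lemma subgroup_bounded_exponent: "subgroup {x \<in> carrier G. x [^] (n::nat) = \<one>} G"
  by (rule subgroupI) (auto simp: nat_pow_inv nat_pow_distrib intro!: exI[of _ \<one>])

text \<open>Duality: the quotient by the \<open>n\<close>-th powers has exponent dividing \<open>n\<close>, so every nontrivial element of
it is detected by a character, namely by one that is injective on the cyclic group generated.\<close>
lemma nth_power_if_characters_vanish:
  assumes n: "n > 0" and fin: "finite (carrier G)" and y: "y \<in> carrier G"
    and van: "\<And>\<psi>. character_on G (carrier G) n \<psi> \<Longrightarrow> [\<psi> y = 0] (mod int n)"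
  shows "y \<in> nth_powers G n"
proof (rule ccontr)
  assume ny: "y \<notin> nth_powers G n"
  define N where "N = nth_powers G n"
  have sub: "subgroup N G" unfolding N_def by (rule nth_powers_subgroup)
  interpret N: normal N G using sub by (simp add: subgroup_imp_normal)
  interpret Q: comm_group "G Mod N" using sub by (rule abelian_FactGroup)
  let ?q = "\<lambda>x. N #> x"
  have q: "?q x \<in> carrier (G Mod N)" if "x \<in> carrier G" for x
    using that by (auto simp: carrier_FactGroup)
  have q1: "?q x = N" if "x \<in> N" for x
    using sub that by (simp add: coset_join2 subgroup.mem_carrier)
  have finQ: "finite (carrier (G Mod N))" using fin by (simp add: carrier_FactGroup)
  have expo: "w [^]\<^bsub>G Mod N\<^esub> n = \<one>\<^bsub>G Mod N\<^esub>" if w: "w \<in> carrier (G Mod N)" for w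
  proof -
    obtain x where x: "x \<in> carrier G" "w = ?q x" using w by (auto simp: carrier_FactGroup)
    then have "w [^]\<^bsub>G Mod N\<^esub> n = ?q (x [^] n)" by (simp add: N.FactGroup_pow)
    moreover have "x [^] n \<in> N" using x by (auto simp: N_def nth_powers_def)
    ultimately show ?thesis by (simp add: q1)
  qed
  have yq: "?q y \<in> carrier (G Mod N)" using q y by blast
  define d where "d = Q.ord (?q y)"
  have "d dvd n" unfolding d_def using expo[OF yq] Q.pow_eq_id[OF yq] by blast
  then obtain k where k: "n = d * k" by (auto simp: dvd_def)
  have "?q y \<noteq> N" using ny y N_def sub by (metis coset_join1 subgroup.subset)
  then have "d \<noteq> 1" using Q.ord_eq_1[OF yq] by (simp add: d_def)
  have "int n dvd int (Q.ord (?q y)) * int k"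
    using k by (simp add: d_def)
  from Q.character_with_value_at[OF n expo finQ yq this] obtain \<psi>
    where \<psi>: "character_on (G Mod N) (carrier (G Mod N)) n \<psi>" "[\<psi> (?q y) = int k] (mod int n)"
    by blast
  have "character_on G (carrier G) n (\<lambda>x. \<psi> (?q x))"
    unfolding character_on_def
  proof (intro ballI)
    fix a b assume ab: "a \<in> carrier G" "b \<in> carrier G"
    have "?q (a \<otimes> b) = ?q a \<otimes>\<^bsub>G Mod N\<^esub> ?q b" using ab by (simp add: N.rcos_sum)
    then show "[\<psi> (?q (a \<otimes> b)) = \<psi> (?q a) + \<psi> (?q b)] (mod int n)"
      using character_onD[OF \<psi>(1) q[OF ab(1)] q[OF ab(2)]] by simp
  qed
  from van[OF this] \<psi>(2) have "[int k = 0] (mod int n)" by (metis cong_sym cong_trans)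
  then have "n dvd k" by (simp add: cong_0_iff)
  moreover have "k > 0" using n k by (cases k) auto
  ultimately have "n \<le> k" by (simp add: dvd_imp_le)
  then show False using k \<open>k > 0\<close> \<open>d \<noteq> 1\<close> n
    by (metis Suc_lessI mult_0 mult_le_cancel2 nat_mult_1 not_less One_nat_def gr0I)
qed

end

section \<open>Commuting homomorphisms between abelian groups\<close>

definition homs_commute ::
  "('a, 'm) monoid_scheme \<Rightarrow> ('b, 'n) monoid_scheme \<Rightarrow> ('b \<Rightarrow> 'a) \<Rightarrow> bool" where
  "homs_commute A Z lam \<longleftrightarrow>
     (\<forall>f\<in>hom A Z. \<forall>g\<in>hom A Z. \<forall>x\<in>carrier A. f (lam (g x)) = g (lam (f x)))"

text \<open>The abelian part of the situation: \<open>A\<close> stands for the abelianisation \<open>G/G'\<close>, \<open>Z\<close> for the centre,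
and \<open>lam\<close> for the natural map. The last assumptions state that \<open>p ^ b\<close>, \<open>p ^ n1\<close> and \<open>p ^ c\<close> are the
exponents of \<open>A\<close>, \<open>R\<close> and the kernel of \<open>lam\<close>, in the form in which they are used: a bound, and an
element that attains it.\<close>
locale central_pairing =
  A: comm_group A + Z: comm_group Z + lam: group_hom Z A lam
  for A :: "('a, 'm) monoid_scheme" and Z :: "('b, 'n) monoid_scheme" and lam :: "'b \<Rightarrow> 'a" +
  fixes p b n1 c :: nat and R :: "'b set"
  assumes prime: "Factorial_Ring.prime p"
    and finA: "finite (carrier A)"
    and expA: "\<And>x. x \<in> carrier A \<Longrightarrow> x [^]\<^bsub>A\<^esub> (p ^ b) = \<one>\<^bsub>A\<^esub>"
    and ordA: "\<exists>\<alpha>\<in>carrier A. group.ord A \<alpha> = p ^ b"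
    and R_def: "R = {r \<in> carrier Z. r [^]\<^bsub>Z\<^esub> (p ^ b) = \<one>\<^bsub>Z\<^esub>}"
    and expR: "\<And>r. r \<in> R \<Longrightarrow> r [^]\<^bsub>Z\<^esub> (p ^ n1) = \<one>\<^bsub>Z\<^esub>"
    and ordR: "\<exists>z\<in>R. group.ord Z z = p ^ n1"
    and expN: "\<And>u. u \<in> carrier Z \<Longrightarrow> lam u = \<one>\<^bsub>A\<^esub> \<Longrightarrow> u [^]\<^bsub>Z\<^esub> (p ^ c) = \<one>\<^bsub>Z\<^esub>"
    and ordN: "\<exists>u\<in>carrier Z. lam u = \<one>\<^bsub>A\<^esub> \<and> group.ord Z u = p ^ c"
begin

lemma R_closed: "r \<in> R \<Longrightarrow> r \<in> carrier Z"
  by (simp add: R_def)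

lemma subgroup_R: "subgroup R Z"
  unfolding R_def
  by (rule Z.subgroup_bounded_exponent)

lemma R_int_pow: "r \<in> R \<Longrightarrow> r [^]\<^bsub>Z\<^esub> (i::int) \<in> R"
  using Z.subgroup_int_pow_closed[OF subgroup_R] .

lemma hom_pow:
  assumes "f \<in> hom A Z" "x \<in> carrier A"
  shows "f (x [^]\<^bsub>A\<^esub> (n::nat)) = f x [^]\<^bsub>Z\<^esub> n" "f (x [^]\<^bsub>A\<^esub> (i::int)) = f x [^]\<^bsub>Z\<^esub> i"
  using hom_nat_pow[OF assms A.is_group Z.is_group] hom_int_pow[OF assms A.is_group Z.is_group]
  by auto

lemma hom_in_R:
  assumes "f \<in> hom A Z" "x \<in> carrier A"
  shows "f x \<in> R"
proof -
  have "f x \<in> carrier Z" using assms by (auto simp: hom_def)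
  moreover have "f x [^]\<^bsub>Z\<^esub> (p ^ b) = f \<one>\<^bsub>A\<^esub>"
    using hom_pow(1)[OF assms, of "p ^ b"] expA[OF assms(2)] by simp
  moreover have "f \<one>\<^bsub>A\<^esub> = \<one>\<^bsub>Z\<^esub>"
    using assms(1) A.is_group Z.is_group hom_one by blast
  ultimately show ?thesis by (simp add: R_def)
qed

lemma lam_R_closed: "r \<in> R \<Longrightarrow> lam r \<in> carrier A"
  using R_closed by simp

text \<open>Here all the composites are trivial, as homomorphisms from \<open>A\<close> take values in \<open>R\<close>.\<close>
theorem homs_commute_if_high_powers:
  assumes "lam ` R \<subseteq> nth_powers A (p ^ n1)"
  shows "homs_commute A Z lam"
proof -
  have trivial: "f (lam (g x)) = \<one>\<^bsub>Z\<^esub>"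
    if fg: "f \<in> hom A Z" "g \<in> hom A Z" and x: "x \<in> carrier A" for f g x
  proof -
    obtain a where a: "a \<in> carrier A" "lam (g x) = a [^]\<^bsub>A\<^esub> (p ^ n1)"
      using assms hom_in_R[OF fg(2) x] by (auto simp: nth_powers_def)
    then have "f (lam (g x)) = f a [^]\<^bsub>Z\<^esub> (p ^ n1)"
      using hom_pow(1)[OF fg(1) a(1)] by simp
    also have "\<dots> = \<one>\<^bsub>Z\<^esub>" by (intro expR hom_in_R fg a)
    finally show ?thesis .
  qed
  show ?thesis
    unfolding homs_commute_def by (intro ballI) (metis trivial)
qed

text \<open>Write \<open>lam r = a [^] p ^ k\<close> and \<open>\<rho> = r [^] p ^ k\<close>. Modulo the kernel of \<open>lam\<close> every element of
\<open>R\<close> is a power of \<open>r\<close>, and \<open>f (a [^] p ^ k)\<close> depends only on \<open>f a\<close> modulo this kernel, because \<open>c \<le> k\<close>. So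
each homomorphism acts on \<open>lam ` R\<close> through a single integer: \<open>f (lam r) = \<rho> [^] u\<close> and \<open>g (lam r) = \<rho> [^] v\<close>. Both composites,
at \<open>x\<close> with \<open>x [^] p ^ k = lam r [^] m\<close>, then equal \<open>\<rho> [^] (u * v * m)\<close>.\<close>
theorem homs_commute_if_cyclic:
  assumes k: "c \<le> k" and pk: "lam ` R = nth_powers A (p ^ k)"
    and r: "r \<in> R" and cyc: "\<And>s. s \<in> R \<Longrightarrow> \<exists>i::int. lam s = lam r [^]\<^bsub>A\<^esub> i"
  shows "homs_commute A Z lam"
  unfolding homs_commute_def
proof (intro ballI)
  fix f g x assume f: "f \<in> hom A Z" and g: "g \<in> hom A Z" and x: "x \<in> carrier A"
  define \<rho> where "\<rho> = r [^]\<^bsub>Z\<^esub> (p ^ k)"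
  have rZ: "r \<in> carrier Z" and \<rho>Z: "\<rho> \<in> carrier Z" using r R_closed by (auto simp: \<rho>_def)
  \<comment> \<open>The kernel of \<open>lam\<close> dies under \<open>p ^ k\<close>-th powers, which therefore factor through \<open>lam\<close>.\<close>
  have power: "s [^]\<^bsub>Z\<^esub> (p ^ k) = \<rho> [^]\<^bsub>Z\<^esub> i"
    if s: "s \<in> R" "lam s = lam r [^]\<^bsub>A\<^esub> (i::int)" for s i
  proof -
    have sZ: "s \<in> carrier Z" using s R_closed by simp
    define u where "u = s \<otimes>\<^bsub>Z\<^esub> inv\<^bsub>Z\<^esub> (r [^]\<^bsub>Z\<^esub> i)"
    have uZ: "u \<in> carrier Z" using sZ rZ by (simp add: u_def)
    have "lam u = lam s \<otimes>\<^bsub>A\<^esub> inv\<^bsub>A\<^esub> (lam r [^]\<^bsub>A\<^esub> i)"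
      using sZ rZ by (simp add: u_def lam.hom_int_pow)
    then have "lam u = \<one>\<^bsub>A\<^esub>" using s(2) rZ by simp
    then have "u [^]\<^bsub>Z\<^esub> (p ^ c) = \<one>\<^bsub>Z\<^esub>" using expN uZ by blast
    then have "(u [^]\<^bsub>Z\<^esub> (p ^ c)) [^]\<^bsub>Z\<^esub> (p ^ (k - c)) = \<one>\<^bsub>Z\<^esub>" by simp
    then have u1: "u [^]\<^bsub>Z\<^esub> (p ^ k) = \<one>\<^bsub>Z\<^esub>"
      using k uZ by (simp add: Z.nat_pow_pow flip: power_add)
    have "s = u \<otimes>\<^bsub>Z\<^esub> r [^]\<^bsub>Z\<^esub> i" using sZ rZ by (simp add: u_def Z.m_assoc)
    then have "s [^]\<^bsub>Z\<^esub> (p ^ k) = (r [^]\<^bsub>Z\<^esub> i) [^]\<^bsub>Z\<^esub> (p ^ k)"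
      using u1 uZ rZ by (simp add: Z.nat_pow_distrib)
    also have "\<dots> = \<rho> [^]\<^bsub>Z\<^esub> i"
      unfolding \<rho>_def using rZ by (metis Z.int_pow_pow int_pow_int mult.commute)
    finally show ?thesis .
  qed
  obtain a where a: "a \<in> carrier A" "lam r = a [^]\<^bsub>A\<^esub> (p ^ k)"
    using pk r by (auto simp: nth_powers_def)
  have on_lam: "\<exists>u::int. \<forall>s\<in>R. \<forall>i::int. lam s = lam r [^]\<^bsub>A\<^esub> i \<longrightarrow> h (lam s) = \<rho> [^]\<^bsub>Z\<^esub> (u * i)"
    if h: "h \<in> hom A Z" for h
  proof -
    obtain u :: int where u: "lam (h a) = lam r [^]\<^bsub>A\<^esub> u" using cyc hom_in_R[OF h a(1)] by blast
    have "h (lam s) = \<rho> [^]\<^bsub>Z\<^esub> (u * i)" if "lam s = lam r [^]\<^bsub>A\<^esub> (i::int)" for s i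
    proof -
      have "h (lam s) = (h a [^]\<^bsub>Z\<^esub> (p ^ k)) [^]\<^bsub>Z\<^esub> i"
        using that a hom_pow[OF h] by simp
      then show ?thesis
        using power[OF hom_in_R[OF h a(1)] u] \<rho>Z by (simp add: Z.int_pow_pow)
    qed
    then show ?thesis by blast
  qed
  obtain u :: int where u: "\<And>s i. s \<in> R \<Longrightarrow> lam s = lam r [^]\<^bsub>A\<^esub> i \<Longrightarrow> f (lam s) = \<rho> [^]\<^bsub>Z\<^esub> (u * i)"
    using on_lam[OF f] by blast
  obtain v :: int where v: "\<And>s i. s \<in> R \<Longrightarrow> lam s = lam r [^]\<^bsub>A\<^esub> i \<Longrightarrow> g (lam s) = \<rho> [^]\<^bsub>Z\<^esub> (v * i)"
    using on_lam[OF g] by blast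
  have fR: "f x \<in> R" and gR: "g x \<in> R" using hom_in_R f g x by auto
  obtain j :: int where j: "lam (f x) = lam r [^]\<^bsub>A\<^esub> j" using cyc[OF fR] by blast
  obtain i :: int where i: "lam (g x) = lam r [^]\<^bsub>A\<^esub> i" using cyc[OF gR] by blast
  have "x [^]\<^bsub>A\<^esub> (p ^ k) \<in> lam ` R" using pk x by (auto simp: nth_powers_def)
  then obtain s where s: "s \<in> R" "lam s = x [^]\<^bsub>A\<^esub> (p ^ k)" by auto
  then obtain m :: int where m: "lam s = lam r [^]\<^bsub>A\<^esub> m" using cyc by blast
  have j': "\<rho> [^]\<^bsub>Z\<^esub> j = \<rho> [^]\<^bsub>Z\<^esub> (u * m)"
    using power[OF fR j] u[OF s(1) m] s(2) hom_pow(1)[OF f x] by simp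
  have i': "\<rho> [^]\<^bsub>Z\<^esub> i = \<rho> [^]\<^bsub>Z\<^esub> (v * m)"
    using power[OF gR i] v[OF s(1) m] s(2) hom_pow(1)[OF g x] by simp
  have "f (lam (g x)) = (\<rho> [^]\<^bsub>Z\<^esub> i) [^]\<^bsub>Z\<^esub> u"
    using u[OF gR i] \<rho>Z by (simp add: Z.int_pow_pow mult.commute)
  also have "\<dots> = (\<rho> [^]\<^bsub>Z\<^esub> j) [^]\<^bsub>Z\<^esub> v"
    unfolding i' j' using \<rho>Z by (simp add: Z.int_pow_pow mult_ac)
  also have "\<dots> = g (lam (f x))"
    using v[OF fR j] \<rho>Z by (simp add: Z.int_pow_pow mult.commute)
  finally show "f (lam (g x)) = g (lam (f x))" .
qed

text \<open>Let \<open>\<alpha>\<close> have maximal order \<open>p ^ b\<close> in \<open>A\<close>, let \<open>\<pi>\<close> be a character modulo \<open>p ^ b\<close> with \<open>\<pi> \<alpha> = 1\<close>, and let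
\<open>z\<close> have maximal order \<open>p ^ n1\<close> in \<open>R\<close>. The homomorphisms to compare are \<open>x \<mapsto> r [^] \<pi> x\<close> for \<open>r\<close> in \<open>R\<close>, and
\<open>x \<mapsto> z [^] \<psi> x\<close> for characters \<open>\<psi>\<close> modulo \<open>p ^ n1\<close>. Put \<open>t = \<pi> (lam z)\<close> and \<open>\<beta> x = x \<otimes> \<alpha> [^] (- \<pi> x)\<close>, the
component of \<open>x\<close> in the complement \<open>ker \<pi>\<close> of \<open>\<langle>\<alpha>\<rangle>\<close>. Commutation gives, with values of \<open>\<psi>\<close> read
modulo \<open>p ^ n1\<close>,

\<^item> \<open>r [^] t = z [^] \<pi> (lam r)\<close>;
\<^item> \<open>\<psi> (lam r) = \<pi> (lam r) * \<psi> \<alpha>\<close> for all \<open>\<psi>\<close>, so \<open>\<beta> (lam r)\<close> is a \<open>p ^ n1\<close>-th power by duality;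
\<^item> \<open>t * \<psi> (\<beta> x) = 0\<close> for all \<open>\<psi>\<close> and \<open>x\<close>.

If \<open>p ^ n1\<close> divides \<open>t\<close>, the first two items put \<open>lam ` R\<close> into the \<open>p ^ n1\<close>-th powers. Otherwise
\<open>t = p ^ k * u\<close> with \<open>k < n1\<close> and \<open>u\<close> prime to \<open>p\<close>. By the third item and duality, \<open>p ^ k\<close>-th powers of elements
of \<open>ker \<pi>\<close> are \<open>p ^ n1\<close>-th powers, which by iteration forces them to vanish. The group of \<open>p ^ k\<close>-th powers of
\<open>A\<close> is therefore \<open>\<langle>\<alpha> [^] p ^ k\<rangle>\<close>, which is \<open>\<langle>lam z\<rangle>\<close> because \<open>lam z = \<alpha> [^] t\<close>.\<close>
theorem homs_commute_imp:
  assumes comm: "homs_commute A Z lam"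
  shows "lam ` R \<subseteq> nth_powers A (p ^ n1) \<or>
    (\<exists>k. c \<le> k \<and> k < n1 \<and> lam ` R = nth_powers A (p ^ k) \<and>
       (\<exists>r\<in>R. \<forall>s\<in>R. \<exists>i::int. lam s = lam r [^]\<^bsub>A\<^esub> i))"
proof -
  have p0: "p > 0" and p1: "p > 1" using prime prime_gt_0_nat prime_gt_1_nat by auto
  obtain \<alpha> where \<alpha>: "\<alpha> \<in> carrier A" "A.ord \<alpha> = p ^ b" using ordA by blast
  obtain z where z: "z \<in> R" "Z.ord z = p ^ n1" using ordR by blast
  have zZ: "z \<in> carrier Z" using z R_closed by blast
  have lz: "lam z \<in> carrier A" using zZ by simp
  have zdvd: "int (p ^ n1) dvd i - j" if "z [^]\<^bsub>Z\<^esub> (i::int) = z [^]\<^bsub>Z\<^esub> j" for i j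
    using Z.int_pow_eq[OF zZ, of i j] that z(2) by (simp add: dvd_diff_commute)
  have "p ^ n1 dvd p ^ b"
    using z Z.pow_eq_id[OF zZ, of "p ^ b"] by (simp add: R_def)
  then have n1b: "n1 \<le> b" using p1 by (simp add: dvd_power_iff_le)
  have "int (p ^ b) dvd int (A.ord \<alpha>) * 1" using \<alpha> by simp
  from A.character_with_value_at[OF _ expA finA \<alpha>(1) this] p0
  obtain \<pi> where \<pi>: "character_on A (carrier A) (p ^ b) \<pi>" "[\<pi> \<alpha> = 1] (mod int (p ^ b))"
    by auto
  note \<pi>_pow = A.character_on_int_pow[OF \<pi>(1) A.subgroup_self]
  have \<alpha>cong: "\<alpha> [^]\<^bsub>A\<^esub> i = \<alpha> [^]\<^bsub>A\<^esub> j" if "[i = j] (mod int (p ^ b))" for i j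
    using A.int_pow_cong[OF \<alpha>(1) expA[OF \<alpha>(1)] that] .
  have Rcong: "r [^]\<^bsub>Z\<^esub> i = r [^]\<^bsub>Z\<^esub> j" if "r \<in> R" "[i = j] (mod int (p ^ b))" for r i j
    using Z.int_pow_cong[OF _ _ that(2)] that(1) by (simp add: R_def)
  have g_hom: "(\<lambda>x. r [^]\<^bsub>Z\<^esub> \<pi> x) \<in> hom A Z" if "r \<in> R" for r
    using Z.character_hom[OF \<pi>(1)] that by (simp add: R_def)
  have g_\<alpha>: "r [^]\<^bsub>Z\<^esub> \<pi> \<alpha> = r" if "r \<in> R" for r
    using Rcong[OF that \<pi>(2)] R_closed[OF that] by simp
  have f_hom: "(\<lambda>x. z [^]\<^bsub>Z\<^esub> \<psi> x) \<in> hom A Z" if "character_on A (carrier A) (p ^ n1) \<psi>" for \<psi>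
    using Z.character_hom[OF that zZ expR[OF z(1)]] .
  have commD: "f (lam (g x)) = g (lam (f x))"
    if "f \<in> hom A Z" "g \<in> hom A Z" "x \<in> carrier A" for f g x
    using comm that by (simp add: homs_commute_def)
  define t where "t = \<pi> (lam z)"
  have pi_exchange: "r [^]\<^bsub>Z\<^esub> t = z [^]\<^bsub>Z\<^esub> \<pi> (lam r)" if r: "r \<in> R" for r
    using commD[OF g_hom[OF r] g_hom[OF z(1)] \<alpha>(1)] g_\<alpha>[OF r] g_\<alpha>[OF z(1)] by (simp add: t_def)
  have \<pi>lz: "r [^]\<^bsub>Z\<^esub> \<pi> (lam (z [^]\<^bsub>Z\<^esub> (i::int))) = r [^]\<^bsub>Z\<^esub> (i * t)" if "r \<in> R" for r i
    using Rcong[OF that \<pi>_pow[OF lz, of i]] zZ by (simp add: lam.hom_int_pow t_def)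
  have psi_on_lam: "[\<psi> (lam r) = \<pi> (lam r) * \<psi> \<alpha>] (mod int (p ^ n1))"
    if \<psi>: "character_on A (carrier A) (p ^ n1) \<psi>" and r: "r \<in> R" for \<psi> r
  proof -
    have "z [^]\<^bsub>Z\<^esub> \<psi> (lam r) = r [^]\<^bsub>Z\<^esub> \<pi> (lam (z [^]\<^bsub>Z\<^esub> \<psi> \<alpha>))"
      using commD[OF f_hom[OF \<psi>] g_hom[OF r] \<alpha>(1)] g_\<alpha>[OF r] by simp
    also have "\<dots> = (r [^]\<^bsub>Z\<^esub> t) [^]\<^bsub>Z\<^esub> \<psi> \<alpha>"
      using \<pi>lz[OF r] R_closed[OF r] by (simp add: Z.int_pow_pow mult.commute)
    also have "\<dots> = z [^]\<^bsub>Z\<^esub> (\<pi> (lam r) * \<psi> \<alpha>)"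
      using pi_exchange[OF r] zZ by (simp add: Z.int_pow_pow)
    finally show ?thesis using zdvd by (simp add: cong_iff_dvd_diff)
  qed
  define \<beta> where "\<beta> x = x \<otimes>\<^bsub>A\<^esub> \<alpha> [^]\<^bsub>A\<^esub> (- \<pi> x)" for x
  have \<beta>c: "\<beta> x \<in> carrier A" if "x \<in> carrier A" for x using that \<alpha> by (simp add: \<beta>_def)
  have decomp: "x = \<beta> x \<otimes>\<^bsub>A\<^esub> \<alpha> [^]\<^bsub>A\<^esub> \<pi> x" if "x \<in> carrier A" for x
    using that \<alpha> by (simp add: \<beta>_def A.int_pow_neg A.m_assoc)
  have char_\<beta>: "[\<psi> (\<beta> x) = \<psi> x - \<pi> x * \<psi> \<alpha>] (mod int m)"
    if \<psi>: "character_on A (carrier A) m \<psi>" and x: "x \<in> carrier A" for \<psi> m x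
  proof -
    have "[\<psi> (\<beta> x) = \<psi> x + \<psi> (\<alpha> [^]\<^bsub>A\<^esub> (- \<pi> x))] (mod int m)"
      unfolding \<beta>_def using \<alpha> x by (intro character_onD[OF \<psi>]) auto
    also have "[\<psi> x + \<psi> (\<alpha> [^]\<^bsub>A\<^esub> (- \<pi> x)) = \<psi> x + - \<pi> x * \<psi> \<alpha>] (mod int m)"
      by (intro cong_add cong_refl A.character_on_int_pow[OF \<psi> A.subgroup_self \<alpha>(1)])
    finally show ?thesis by simp
  qed
  have beta_lam_power: "\<beta> (lam r) \<in> nth_powers A (p ^ n1)" if r: "r \<in> R" for r
  proof (rule A.nth_power_if_characters_vanish)
    fix \<psi> assume \<psi>: "character_on A (carrier A) (p ^ n1) \<psi>"
    have "[\<psi> (\<beta> (lam r)) = \<psi> (lam r) - \<pi> (lam r) * \<psi> \<alpha>] (mod int (p ^ n1))"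
      by (rule char_\<beta>[OF \<psi> lam_R_closed[OF r]])
    also have "[\<psi> (lam r) - \<pi> (lam r) * \<psi> \<alpha> = 0] (mod int (p ^ n1))"
      using psi_on_lam[OF \<psi> r] by (simp add: cong_diff_iff_cong_0)
    finally show "[\<psi> (\<beta> (lam r)) = 0] (mod int (p ^ n1))" .
  qed (use p0 finA \<beta>c lam_R_closed[OF r] in auto)
  have mult_power: "x [^]\<^bsub>A\<^esub> (int (p ^ k) * i) \<in> nth_powers A (p ^ k)"
    if "x \<in> carrier A" for x k i
  proof -
    have "x [^]\<^bsub>A\<^esub> (int (p ^ k) * i) = (x [^]\<^bsub>A\<^esub> i) [^]\<^bsub>A\<^esub> (p ^ k)"
      using that by (metis A.int_pow_pow int_pow_int mult.commute)
    then show ?thesis using that unfolding nth_powers_def by blast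
  qed
  have prod_power: "x \<otimes>\<^bsub>A\<^esub> y \<in> nth_powers A m" if "x \<in> nth_powers A m" "y \<in> nth_powers A m" for x y m
    using subgroup.m_closed[OF A.nth_powers_subgroup that] .
  show ?thesis
  proof (cases "int (p ^ n1) dvd t")
    case True
    have "lam r \<in> nth_powers A (p ^ n1)" if r: "r \<in> R" for r
    proof -
      have "r [^]\<^bsub>Z\<^esub> t = r [^]\<^bsub>Z\<^esub> (0::int)"
        using True by (intro Z.int_pow_cong[OF R_closed[OF r] expR[OF r]]) (simp add: cong_0_iff)
      then have "z [^]\<^bsub>Z\<^esub> \<pi> (lam r) = z [^]\<^bsub>Z\<^esub> (0::int)" using pi_exchange[OF r] by simp
      from zdvd[OF this] obtain s where s: "\<pi> (lam r) = int (p ^ n1) * s" by (auto simp: dvd_def)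
      show ?thesis
        using decomp[OF lam_R_closed[OF r]] prod_power[OF beta_lam_power[OF r] mult_power[OF \<alpha>(1)]] s by metis
    qed
    then show ?thesis by blast
  next
    case False
    then have t0: "t \<noteq> 0" by auto
    have primei: "Factorial_Ring.prime (int p)" using prime by simp
    then have "\<not> is_unit (int p)" using not_prime_unit by blast
    from multiplicity_decompose'[OF t0 this] obtain u
      where u: "t = int p ^ multiplicity (int p) t * u" "\<not> int p dvd u" by blast
    define k where "k = multiplicity (int p) t"
    have t: "t = int (p ^ k) * u" using u by (simp add: k_def)
    have cop: "coprime (int p ^ i) u" for i
      using u(2) primei by (simp add: prime_imp_coprime)
    have k: "k < n1"
    proof (rule ccontr)
      assume "\<not> k < n1"
      then have "int (p ^ n1) dvd int (p ^ k)" by (simp add: le_imp_power_dvd)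
      with False t show False by simp
    qed
    have pn1: "int (p ^ n1) = int (p ^ k) * int (p ^ (n1 - k))"
      using k by (simp flip: power_add)
    \<comment> \<open>Raising \<open>r [^] t = z [^] \<pi> (lam r)\<close> to the power \<open>p ^ (n1 - k)\<close> kills the left-hand side.\<close>
    have pi_lam_dvd: "int (p ^ k) dvd \<pi> (lam r)" if r: "r \<in> R" for r
    proof -
      have "z [^]\<^bsub>Z\<^esub> (\<pi> (lam r) * int (p ^ (n1 - k))) = (r [^]\<^bsub>Z\<^esub> t) [^]\<^bsub>Z\<^esub> int (p ^ (n1 - k))"
        using pi_exchange[OF r] zZ by (simp add: Z.int_pow_pow)
      also have "\<dots> = r [^]\<^bsub>Z\<^esub> (t * int (p ^ (n1 - k)))"
        using R_closed[OF r] by (simp add: Z.int_pow_pow)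
      also have "t * int (p ^ (n1 - k)) = int (p ^ n1) * u" unfolding pn1 t by simp
      also have "r [^]\<^bsub>Z\<^esub> (int (p ^ n1) * u) = r [^]\<^bsub>Z\<^esub> (0::int)"
        by (intro Z.int_pow_cong[OF R_closed[OF r] expR[OF r]]) (simp add: cong_0_iff)
      also have "\<dots> = z [^]\<^bsub>Z\<^esub> (0::int)" by simp
      finally have "int (p ^ n1) dvd \<pi> (lam r) * int (p ^ (n1 - k))" using zdvd by fastforce
      then show ?thesis unfolding pn1 using p0 by simp
    qed
    \<comment> \<open>The two composites at \<open>x\<close> are \<open>z [^] (\<pi> x * (t * \<psi> \<alpha>))\<close> and \<open>z [^] (\<psi> x * t)\<close>; the factor \<open>u\<close> of \<open>t\<close> cancels.\<close>
    have beta_power: "\<beta> x [^]\<^bsub>A\<^esub> (p ^ k) \<in> nth_powers A (p ^ n1)" if x: "x \<in> carrier A" for x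
    proof (rule A.nth_power_if_characters_vanish)
      fix \<psi> assume \<psi>: "character_on A (carrier A) (p ^ n1) \<psi>"
      note \<psi>_pow = A.character_on_int_pow[OF \<psi> A.subgroup_self]
      have "[\<psi> (lam (z [^]\<^bsub>Z\<^esub> \<pi> x)) = \<pi> x * \<psi> (lam z)] (mod int (p ^ n1))"
        using \<psi>_pow[OF lz, of "\<pi> x"] zZ by (simp add: lam.hom_int_pow)
      also have "[\<pi> x * \<psi> (lam z) = \<pi> x * (t * \<psi> \<alpha>)] (mod int (p ^ n1))"
        using psi_on_lam[OF \<psi> z(1)] by (intro cong_scalar_left) (simp add: t_def)
      finally have "z [^]\<^bsub>Z\<^esub> \<psi> (lam (z [^]\<^bsub>Z\<^esub> \<pi> x)) = z [^]\<^bsub>Z\<^esub> (\<pi> x * (t * \<psi> \<alpha>))"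
        by (intro Z.int_pow_cong[OF zZ expR[OF z(1)]])
      moreover have "z [^]\<^bsub>Z\<^esub> \<psi> (lam (z [^]\<^bsub>Z\<^esub> \<pi> x)) = z [^]\<^bsub>Z\<^esub> \<pi> (lam (z [^]\<^bsub>Z\<^esub> \<psi> x))"
        using commD[OF f_hom[OF \<psi>] g_hom[OF z(1)] x] .
      ultimately have "z [^]\<^bsub>Z\<^esub> (\<psi> x * t) = z [^]\<^bsub>Z\<^esub> (\<pi> x * (t * \<psi> \<alpha>))"
        using \<pi>lz[OF z(1)] by simp
      from zdvd[OF this] have "int (p ^ n1) dvd u * (int (p ^ k) * (\<psi> x - \<pi> x * \<psi> \<alpha>))"
        by (simp add: t algebra_simps)
      then have d: "int (p ^ n1) dvd int (p ^ k) * (\<psi> x - \<pi> x * \<psi> \<alpha>)"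
        using cop[of n1] by (simp add: coprime_dvd_mult_right_iff)
      have "[\<psi> (\<beta> x [^]\<^bsub>A\<^esub> (p ^ k)) = int (p ^ k) * \<psi> (\<beta> x)] (mod int (p ^ n1))"
        by (rule A.character_on_nat_pow[OF \<psi> A.subgroup_self \<beta>c[OF x]])
      also have "[int (p ^ k) * \<psi> (\<beta> x) = int (p ^ k) * (\<psi> x - \<pi> x * \<psi> \<alpha>)] (mod int (p ^ n1))"
        by (intro cong_scalar_left char_\<beta>[OF \<psi> x])
      also have "[int (p ^ k) * (\<psi> x - \<pi> x * \<psi> \<alpha>) = 0] (mod int (p ^ n1))"
        using d by (simp add: cong_0_iff)
      finally show "[\<psi> (\<beta> x [^]\<^bsub>A\<^esub> (p ^ k)) = 0] (mod int (p ^ n1))" .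
    qed (use p0 finA \<beta>c[OF x] in auto)
    \<comment> \<open>The complement \<open>ker \<pi>\<close> of \<open>\<langle>\<alpha>\<rangle>\<close>.\<close>
    define K where "K = {y \<in> carrier A. int (p ^ b) dvd \<pi> y}"
    have \<beta>K: "\<beta> x \<in> K" if x: "x \<in> carrier A" for x
    proof -
      have "[\<pi> (\<beta> x) = \<pi> x - \<pi> x * \<pi> \<alpha>] (mod int (p ^ b))" by (rule char_\<beta>[OF \<pi>(1) x])
      also have "[\<pi> x - \<pi> x * \<pi> \<alpha> = \<pi> x - \<pi> x * 1] (mod int (p ^ b))"
        by (intro cong_diff cong_refl cong_scalar_left \<pi>(2))
      finally show ?thesis using \<beta>c[OF x] by (simp add: K_def cong_0_iff)
    qed
    have K_pow: "y [^]\<^bsub>A\<^esub> (n::nat) \<in> K" if "y \<in> K" for y n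
    proof -
      have "[\<pi> (y [^]\<^bsub>A\<^esub> n) = int n * \<pi> y] (mod int (p ^ b))"
        using that by (intro A.character_on_nat_pow[OF \<pi>(1) A.subgroup_self]) (simp add: K_def)
      also have "[int n * \<pi> y = 0] (mod int (p ^ b))" using that by (simp add: K_def cong_0_iff)
      finally show ?thesis using that by (simp add: K_def cong_0_iff)
    qed
    \<comment> \<open>As \<open>k < n1\<close>, one more factor \<open>p\<close> can be pulled out of the exponent without leaving \<open>ker \<pi>\<close>.\<close>
    have step: "\<exists>w\<in>K. y [^]\<^bsub>A\<^esub> (p ^ k) = w [^]\<^bsub>A\<^esub> (p ^ Suc k)" if y: "y \<in> K" for y
    proof -
      have yA: "y \<in> carrier A" using y by (simp add: K_def)
      have "\<alpha> [^]\<^bsub>A\<^esub> (- \<pi> y) = \<alpha> [^]\<^bsub>A\<^esub> (0::int)"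
        using y by (intro \<alpha>cong) (simp add: K_def cong_0_iff)
      then have "\<beta> y = y" using yA by (simp add: \<beta>_def)
      with beta_power[OF yA] obtain w where w: "w \<in> carrier A" "y [^]\<^bsub>A\<^esub> (p ^ k) = w [^]\<^bsub>A\<^esub> (p ^ n1)"
        by (auto simp: nth_powers_def)
      define v where "v = \<beta> w"
      have vK: "v \<in> K" and vA: "v \<in> carrier A" using \<beta>K \<beta>c w by (auto simp: v_def)
      have "w = v \<otimes>\<^bsub>A\<^esub> \<alpha> [^]\<^bsub>A\<^esub> \<pi> w" using decomp w by (simp add: v_def)
      then have "w [^]\<^bsub>A\<^esub> (p ^ n1) = v [^]\<^bsub>A\<^esub> (p ^ n1) \<otimes>\<^bsub>A\<^esub> (\<alpha> [^]\<^bsub>A\<^esub> \<pi> w) [^]\<^bsub>A\<^esub> (p ^ n1)"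
        using vA \<alpha> by (metis A.int_pow_closed A.nat_pow_distrib)
      also have "(\<alpha> [^]\<^bsub>A\<^esub> \<pi> w) [^]\<^bsub>A\<^esub> (p ^ n1) = \<alpha> [^]\<^bsub>A\<^esub> (int (p ^ n1) * \<pi> w)"
        using \<alpha> by (metis A.int_pow_pow int_pow_int mult.commute)
      also have "\<dots> = \<alpha> [^]\<^bsub>A\<^esub> (0::int)"
      proof (rule \<alpha>cong)
        have "[\<pi> (w [^]\<^bsub>A\<^esub> (p ^ n1)) = int (p ^ n1) * \<pi> w] (mod int (p ^ b))"
          by (rule A.character_on_nat_pow[OF \<pi>(1) A.subgroup_self w(1)])
        moreover have "[\<pi> (w [^]\<^bsub>A\<^esub> (p ^ n1)) = 0] (mod int (p ^ b))"
          using K_pow[OF y, of "p ^ k"] w(2) by (simp add: K_def cong_0_iff)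
        ultimately show "[int (p ^ n1) * \<pi> w = 0] (mod int (p ^ b))"
          by (metis cong_sym cong_trans)
      qed
      finally have "y [^]\<^bsub>A\<^esub> (p ^ k) = v [^]\<^bsub>A\<^esub> (p ^ n1)" using w(2) vA by simp
      also have "p ^ n1 = p ^ (n1 - Suc k) * p ^ Suc k"
        using k by (simp del: power_Suc flip: power_add)
      also have "v [^]\<^bsub>A\<^esub> \<dots> = (v [^]\<^bsub>A\<^esub> (p ^ (n1 - Suc k))) [^]\<^bsub>A\<^esub> (p ^ Suc k)"
        using vA by (simp only: A.nat_pow_pow)
      finally show ?thesis using K_pow[OF vK] by blast
    qed
    have K_deep: "\<exists>w\<in>K. y [^]\<^bsub>A\<^esub> (p ^ k) = w [^]\<^bsub>A\<^esub> (p ^ (k + j))" if y: "y \<in> K" for y j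
    proof (induction j)
      case 0
      show ?case using y by auto
    next
      case (Suc j)
      then obtain w where w: "w \<in> K" "y [^]\<^bsub>A\<^esub> (p ^ k) = w [^]\<^bsub>A\<^esub> (p ^ (k + j))" by blast
      from step[OF w(1)] obtain v where v: "v \<in> K" "w [^]\<^bsub>A\<^esub> (p ^ k) = v [^]\<^bsub>A\<^esub> (p ^ Suc k)" by blast
      have wA: "w \<in> carrier A" and vA: "v \<in> carrier A" using w v by (auto simp: K_def)
      have "w [^]\<^bsub>A\<^esub> (p ^ (k + j)) = (v [^]\<^bsub>A\<^esub> (p ^ Suc k)) [^]\<^bsub>A\<^esub> (p ^ j)"
        using wA v(2) by (metis A.nat_pow_pow power_add)
      also have "\<dots> = v [^]\<^bsub>A\<^esub> (p ^ (k + Suc j))"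
        using vA by (metis A.nat_pow_pow power_add add_Suc_shift)
      finally show ?case using w v by auto
    qed
    have K1: "y [^]\<^bsub>A\<^esub> (p ^ k) = \<one>\<^bsub>A\<^esub>" if y: "y \<in> K" for y
    proof -
      obtain w where w: "w \<in> K" "y [^]\<^bsub>A\<^esub> (p ^ k) = w [^]\<^bsub>A\<^esub> (p ^ (k + b))"
        using K_deep[OF y] by blast
      have wA: "w \<in> carrier A" using w by (simp add: K_def)
      have "w [^]\<^bsub>A\<^esub> (p ^ (k + b)) = (w [^]\<^bsub>A\<^esub> (p ^ b)) [^]\<^bsub>A\<^esub> (p ^ k)"
        using wA by (metis A.nat_pow_pow power_add add.commute)
      then show ?thesis using w(2) expA[OF wA] by simp
    qed
    have power_in_cyclic: "x [^]\<^bsub>A\<^esub> (p ^ k) = \<alpha> [^]\<^bsub>A\<^esub> (\<pi> x * int (p ^ k))" if x: "x \<in> carrier A" for x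
    proof -
      have "x [^]\<^bsub>A\<^esub> (p ^ k) = \<beta> x [^]\<^bsub>A\<^esub> (p ^ k) \<otimes>\<^bsub>A\<^esub> (\<alpha> [^]\<^bsub>A\<^esub> \<pi> x) [^]\<^bsub>A\<^esub> (p ^ k)"
        using decomp[OF x] \<beta>c[OF x] \<alpha>(1) by (metis A.int_pow_closed A.nat_pow_distrib)
      also have "\<dots> = (\<alpha> [^]\<^bsub>A\<^esub> \<pi> x) [^]\<^bsub>A\<^esub> (p ^ k)"
        using K1[OF \<beta>K[OF x]] \<alpha>(1) by simp
      also have "\<dots> = \<alpha> [^]\<^bsub>A\<^esub> (\<pi> x * int (p ^ k))"
        using \<alpha>(1) by (metis A.int_pow_pow int_pow_int)
      finally show ?thesis .
    qed
    have sub: "lam r \<in> nth_powers A (p ^ k)" if r: "r \<in> R" for r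
    proof -
      obtain w where w: "w \<in> carrier A" "\<beta> (lam r) = w [^]\<^bsub>A\<^esub> (p ^ n1)"
        using beta_lam_power[OF r] by (auto simp: nth_powers_def)
      have "w [^]\<^bsub>A\<^esub> (p ^ n1) = w [^]\<^bsub>A\<^esub> (int (p ^ k) * int (p ^ (n1 - k)))"
        using pn1 by (metis int_pow_int)
      then have "\<beta> (lam r) \<in> nth_powers A (p ^ k)"
        using mult_power[OF w(1)] w(2) by simp
      moreover obtain s where "\<pi> (lam r) = int (p ^ k) * s" using pi_lam_dvd[OF r] by (auto simp: dvd_def)
      ultimately show ?thesis
        using decomp[OF lam_R_closed[OF r]] prod_power mult_power[OF \<alpha>(1)] by metis
    qed
    have lz_eq: "lam z = \<alpha> [^]\<^bsub>A\<^esub> t"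
    proof -
      obtain x where x: "x \<in> carrier A" "lam z = x [^]\<^bsub>A\<^esub> (p ^ k)"
        using sub[OF z(1)] by (auto simp: nth_powers_def)
      have "[t = int (p ^ k) * \<pi> x] (mod int (p ^ b))"
        unfolding t_def x(2) by (rule A.character_on_nat_pow[OF \<pi>(1) A.subgroup_self x(1)])
      then have "\<alpha> [^]\<^bsub>A\<^esub> t = \<alpha> [^]\<^bsub>A\<^esub> (int (p ^ k) * \<pi> x)" by (rule \<alpha>cong)
      then show ?thesis using x power_in_cyclic[OF x(1)] by (simp add: mult.commute)
    qed
    \<comment> \<open>An inverse \<open>v\<close> of \<open>u\<close> turns \<open>lam z = \<alpha> [^] t\<close> into a generator of \<open>\<langle>\<alpha> [^] p ^ k\<rangle>\<close>.\<close>
    have "coprime u (int (p ^ b))" using cop[of b] by (simp add: coprime_commute)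
    from cong_solve_coprime_int[OF this] obtain v where v: "[u * v = 1] (mod int (p ^ b))" by blast
    have gen: "x [^]\<^bsub>A\<^esub> (p ^ k) = lam z [^]\<^bsub>A\<^esub> (v * \<pi> x)" if x: "x \<in> carrier A" for x
    proof -
      have "lam z [^]\<^bsub>A\<^esub> (v * \<pi> x) = \<alpha> [^]\<^bsub>A\<^esub> (t * (v * \<pi> x))"
        using \<alpha> lz_eq by (simp add: A.int_pow_pow)
      also have "\<dots> = \<alpha> [^]\<^bsub>A\<^esub> (1 * (\<pi> x * int (p ^ k)))"
      proof (rule \<alpha>cong)
        have "[(u * v) * (\<pi> x * int (p ^ k)) = 1 * (\<pi> x * int (p ^ k))] (mod int (p ^ b))"
          by (intro cong_scalar_right v)
        then show "[t * (v * \<pi> x) = 1 * (\<pi> x * int (p ^ k))] (mod int (p ^ b))"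
          by (simp add: t mult_ac)
      qed
      finally show ?thesis using power_in_cyclic[OF x] by simp
    qed
    have "lam ` R = nth_powers A (p ^ k)"
    proof (intro equalityI subsetI)
      fix y assume "y \<in> nth_powers A (p ^ k)"
      then obtain x where x: "x \<in> carrier A" "y = x [^]\<^bsub>A\<^esub> (p ^ k)" by (auto simp: nth_powers_def)
      then have "y = lam (z [^]\<^bsub>Z\<^esub> (v * \<pi> x))" using gen zZ by (simp add: lam.hom_int_pow)
      then show "y \<in> lam ` R" using R_int_pow[OF z(1)] by blast
    qed (use sub in blast)
    moreover have "\<exists>i::int. lam s = lam z [^]\<^bsub>A\<^esub> i" if "s \<in> R" for s
      using sub[OF that] gen by (auto simp: nth_powers_def)
    moreover have "c \<le> k"
    proof -
      \<comment> \<open>For \<open>w\<close> in the kernel, \<open>w [^] t = z [^] \<pi> (lam w) = \<one>\<close>, so the order of \<open>w\<close> divides \<open>p ^ k * u\<close>.\<close>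
      have le: "e \<le> k" if w: "w \<in> R" "lam w = \<one>\<^bsub>A\<^esub>" "Z.ord w = p ^ e" for w e
      proof -
        have "int (p ^ n1) dvd int (p ^ b)" using n1b by (simp add: le_imp_power_dvd)
        then have "[\<pi> \<one>\<^bsub>A\<^esub> = 0] (mod int (p ^ n1))"
          using A.character_on_one[OF \<pi>(1) A.subgroup_self] cong_dvd_modulus by blast
        then have "z [^]\<^bsub>Z\<^esub> \<pi> \<one>\<^bsub>A\<^esub> = z [^]\<^bsub>Z\<^esub> (0::int)"
          by (intro Z.int_pow_cong[OF zZ expR[OF z(1)]])
        then have "w [^]\<^bsub>Z\<^esub> t = \<one>\<^bsub>Z\<^esub>" using pi_exchange[OF w(1)] w(2) by simp
        then have "int (p ^ e) dvd int (p ^ k) * u"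
          using Z.int_pow_eq_id[OF R_closed[OF w(1)], of t] w(3) t by simp
        then have "int p ^ e dvd int p ^ k"
          using cop[of e] by (simp add: coprime_dvd_mult_left_iff)
        then have "p ^ e dvd p ^ k" by (metis of_nat_dvd_iff of_nat_power)
        then show ?thesis using p1 by (simp add: dvd_power_iff_le)
      qed
      obtain w where w: "w \<in> carrier Z" "lam w = \<one>\<^bsub>A\<^esub>" "Z.ord w = p ^ c" using ordN by blast
      show ?thesis
      proof (cases "c \<le> b")
        case True
        then have "w \<in> R"
          using w by (simp add: R_def Z.pow_eq_id le_imp_power_dvd)
        then show ?thesis using le w by blast
      next
        case False
        \<comment> \<open>Otherwise a power of \<open>w\<close> lies in \<open>R\<close> and has order \<open>p ^ b\<close>, contradicting \<open>k < n1 \<le> b\<close>.\<close>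
        define v where "v = w [^]\<^bsub>Z\<^esub> (p ^ (c - b))"
        have "p ^ c = p ^ (c - b) * p ^ b" using False by (simp flip: power_add)
        then have v: "Z.ord v = p ^ b"
          unfolding v_def using w p0 by (simp add: Z.ord_pow)
        have vZ: "v \<in> carrier Z" using w by (simp add: v_def)
        then have "v \<in> R" using v Z.pow_ord_eq_1[OF vZ] by (simp add: R_def)
        moreover have "lam v = \<one>\<^bsub>A\<^esub>" using w by (simp add: v_def lam.hom_nat_pow)
        ultimately have "b \<le> k" using le v by blast
        then show ?thesis using k n1b by simp
      qed
    qed
    ultimately show ?thesis using k z(1) by blast
  qed
qed

end

section \<open>Central endomorphisms of purely non-abelian groups\<close>

abbreviation center_group :: "('a, 'b) monoid_scheme \<Rightarrow> ('a, 'b) monoid_scheme" where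
  "center_group G \<equiv> G\<lparr>carrier := group_center G\<rparr>"

definition central_endomorphism :: "('a, 'b) monoid_scheme \<Rightarrow> ('a \<Rightarrow> 'a) \<Rightarrow> bool" where
  "central_endomorphism G \<sigma> \<longleftrightarrow>
     \<sigma> \<in> hom G G \<and> (\<forall>g \<in> carrier G. inv\<^bsub>G\<^esub> g \<otimes>\<^bsub>G\<^esub> \<sigma> g \<in> group_center G)"

context group
begin

lemma rcoset_eq_iff:
  assumes "subgroup H G" "x \<in> carrier G" "y \<in> carrier G"
  shows "H #> x = H #> y \<longleftrightarrow> x \<otimes> inv y \<in> H"
proof
  assume "H #> x = H #> y"
  then have "x \<in> H #> y" using assms rcos_self by blast
  then show "x \<otimes> inv y \<in> H"
    using subgroup.rcos_module[OF assms(1) is_group assms(3,2)] by simp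
next
  assume "x \<otimes> inv y \<in> H"
  then have "x \<in> H #> y"
    using subgroup.rcos_module[OF assms(1) is_group assms(3,2)] by simp
  then show "H #> x = H #> y" using repr_independence assms by metis
qed

lemma center_closed: "z \<in> group_center G \<Longrightarrow> z \<in> carrier G"
  by (simp add: group_center_def)

lemma center_commute: "z \<in> group_center G \<Longrightarrow> g \<in> carrier G \<Longrightarrow> z \<otimes> g = g \<otimes> z"
  by (simp add: group_center_def)

lemma center_subgroup: "subgroup (group_center G) G"
proof (rule subgroupI)
  fix a assume a: "a \<in> group_center G"
  have aG: "a \<in> carrier G" by (rule center_closed[OF a])
  show "inv a \<in> group_center G"
    unfolding group_center_def
  proof (intro CollectI conjI ballI)
    fix g assume g: "g \<in> carrier G"
    have "inv (inv g \<otimes> a) = inv (a \<otimes> inv g)" using center_commute[OF a] g by simp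
    then show "inv a \<otimes> g = g \<otimes> inv a" using aG g by (simp add: inv_mult_group)
  qed (use aG in simp)
  fix b assume b: "b \<in> group_center G"
  have bG: "b \<in> carrier G" by (rule center_closed[OF b])
  show "a \<otimes> b \<in> group_center G"
    unfolding group_center_def
  proof (intro CollectI conjI ballI)
    fix g assume g: "g \<in> carrier G"
    have "a \<otimes> b \<otimes> g = a \<otimes> (g \<otimes> b)" using center_commute[OF b g] aG bG g by (simp add: m_assoc)
    also have "\<dots> = g \<otimes> (a \<otimes> b)" using center_commute[OF a g] aG bG g by (simp flip: m_assoc)
    finally show "a \<otimes> b \<otimes> g = g \<otimes> (a \<otimes> b)" .
  qed (use aG bG in simp)
qed (auto simp: group_center_def intro!: exI[of _ \<one>])

lemma center_comm_group: "comm_group (center_group G)"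
proof (rule group.group_comm_groupI)
  show "group (center_group G)" using subgroup_imp_group[OF center_subgroup] .
qed (use center_commute center_closed in simp)

lemma central_endomorphism_decomp:
  assumes "central_endomorphism G \<sigma>" "g \<in> carrier G"
  obtains z where "z \<in> group_center G" "\<sigma> g = g \<otimes> z"
proof
  show "inv g \<otimes> \<sigma> g \<in> group_center G" using assms by (simp add: central_endomorphism_def)
  show "\<sigma> g = g \<otimes> (inv g \<otimes> \<sigma> g)"
    using assms by (simp add: central_endomorphism_def Pi_iff hom_def flip: m_assoc)
qed

lemma central_endomorphismI:
  assumes "\<sigma> \<in> hom G G" "\<And>g. g \<in> carrier G \<Longrightarrow> \<exists>z\<in>group_center G. \<sigma> g = g \<otimes> z"
  shows "central_endomorphism G \<sigma>"
  unfolding central_endomorphism_def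
proof (intro conjI ballI)
  fix g assume g: "g \<in> carrier G"
  obtain z where z: "z \<in> group_center G" "\<sigma> g = g \<otimes> z" using assms(2)[OF g] by blast
  have "inv g \<otimes> \<sigma> g = z" using z g center_closed by (simp flip: m_assoc)
  then show "inv g \<otimes> \<sigma> g \<in> group_center G" using z by simp
qed (rule assms(1))

lemma central_endomorphism_comp:
  assumes "central_endomorphism G \<sigma>" "central_endomorphism G \<tau>"
  shows "central_endomorphism G (\<sigma> \<circ> \<tau>)"
proof (rule central_endomorphismI)
  show "\<sigma> \<circ> \<tau> \<in> hom G G"
    using assms by (auto simp: central_endomorphism_def intro: Group.hom_compose)
  fix g assume g: "g \<in> carrier G"
  obtain z where z: "z \<in> group_center G" "\<tau> g = g \<otimes> z"
    by (rule central_endomorphism_decomp[OF assms(2) g])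
  have "\<tau> g \<in> carrier G" using z g center_closed by simp
  then obtain w where w: "w \<in> group_center G" "\<sigma> (\<tau> g) = \<tau> g \<otimes> w"
    by (rule central_endomorphism_decomp[OF assms(1)])
  have "(\<sigma> \<circ> \<tau>) g = g \<otimes> (z \<otimes> w)" using z w g center_closed by (simp add: m_assoc)
  then show "\<exists>z\<in>group_center G. (\<sigma> \<circ> \<tau>) g = g \<otimes> z"
    using subgroup.m_closed[OF center_subgroup] z w by blast
qed

lemma central_endomorphism_funpow:
  assumes "central_endomorphism G \<sigma>"
  shows "central_endomorphism G (\<sigma> ^^ n)"
proof (induction n)
  case 0
  have "\<exists>z\<in>group_center G. g = g \<otimes> z" if "g \<in> carrier G" for g
    using that subgroup.one_closed[OF center_subgroup] by (metis r_one)
  then show ?case by (intro central_endomorphismI) (auto simp: hom_def)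
next
  case (Suc n)
  then show ?case using central_endomorphism_comp[OF assms Suc.IH] by (simp add: o_def)
qed

text \<open>Fitting's decomposition: once the image of \<open>e\<close> is stable, \<open>G\<close> is the direct product of kernel and image.
The image is normal because \<open>e g\<close> and \<open>g\<close> act by the same conjugation, and the kernel is
central because \<open>e g = g \<otimes> z\<close> with \<open>z\<close> central. So the kernel is an abelian direct factor.\<close>
lemma central_endomorphism_kernel_trivial_if_stable:
  assumes pn: "purely_nonabelian G" and fin: "finite (carrier G)"
    and e: "central_endomorphism G e" and stable: "e ` e ` carrier G = e ` carrier G"
    and x: "x \<in> carrier G" "e x = \<one>"
  shows "x = \<one>"
proof -
  have eh: "e \<in> hom G G" using e by (simp add: central_endomorphism_def)
  interpret e: group_hom G G e using eh by (simp add: group_hom_def group_hom_axioms_def)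
  define K where "K = kernel G G e"
  define I where "I = e ` carrier G"
  have Kc: "K \<subseteq> group_center G"
  proof
    fix y assume "y \<in> K"
    then have y: "y \<in> carrier G" "e y = \<one>" by (auto simp: K_def kernel_def)
    then obtain z where z: "z \<in> group_center G" "\<one> = y \<otimes> z"
      using central_endomorphism_decomp[OF e y(1)] by metis
    then have "y = inv z" using y center_closed by (metis inv_equality)
    then show "y \<in> group_center G" using subgroup.m_inv_closed[OF center_subgroup] z by simp
  qed
  have inj: "inj_on e I"
    using stable fin by (intro eq_card_imp_inj_on) (auto simp: I_def)
  have nK: "K \<lhd> G" unfolding K_def by (rule e.normal_kernel)
  have subI: "subgroup I G" unfolding I_def by (rule e.img_is_subgroup)
  have nI: "I \<lhd> G"
    unfolding normal_inv_iff
  proof (intro conjI ballI subI)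
    fix g i assume g: "g \<in> carrier G" and "i \<in> I"
    then obtain y where y: "y \<in> carrier G" "i = e y" by (auto simp: I_def)
    obtain z where z: "z \<in> group_center G" "e g = g \<otimes> z"
      by (rule central_endomorphism_decomp[OF e g])
    have zG: "z \<in> carrier G" by (rule center_closed[OF z(1)])
    have "e (g \<otimes> y \<otimes> inv g) = g \<otimes> z \<otimes> e y \<otimes> inv (g \<otimes> z)"
      using g y z by simp
    also have "\<dots> = g \<otimes> (z \<otimes> e y \<otimes> inv z) \<otimes> inv g"
      using g y zG by (simp add: inv_mult_group m_assoc)
    also have "z \<otimes> e y \<otimes> inv z = e y"
      using center_commute[OF z(1)] y zG by (simp add: m_assoc)
    finally have "g \<otimes> i \<otimes> inv g = e (g \<otimes> y \<otimes> inv g)" using y by simp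
    moreover have "g \<otimes> y \<otimes> inv g \<in> carrier G" using g y by simp
    ultimately show "g \<otimes> i \<otimes> inv g \<in> I" unfolding I_def by blast
  qed
  have int: "K \<inter> I = {\<one>}"
  proof -
    have "y = \<one>" if y: "y \<in> K" "y \<in> I" for y
    proof -
      have "e y = e \<one>" using y by (simp add: K_def kernel_def)
      moreover have "\<one> \<in> I" by (rule subgroup.one_closed[OF subI])
      ultimately show ?thesis using inj_onD[OF inj] y by blast
    qed
    moreover have "\<one> \<in> K" by (simp add: K_def kernel_def)
    ultimately show ?thesis using subgroup.one_closed[OF subI] by blast
  qed
  have prod: "K <#> I = carrier G"
  proof (intro equalityI subsetI)
    fix g assume g: "g \<in> carrier G"
    then have "e g \<in> e ` I" using stable by (simp add: I_def)
    then obtain i where i: "i \<in> I" "e g = e i" by blast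
    have iG: "i \<in> carrier G" using i subI subgroup.mem_carrier by metis
    have "g \<otimes> inv i \<in> K" using g iG i(2) by (simp add: K_def kernel_def)
    moreover have "g = (g \<otimes> inv i) \<otimes> i" using g iG by (simp add: m_assoc)
    ultimately show "g \<in> K <#> I" using i(1) unfolding set_mult_def by blast
  next
    fix g assume "g \<in> K <#> I"
    then show "g \<in> carrier G"
      using subgroup.mem_carrier[OF subI] by (auto simp: set_mult_def K_def kernel_def)
  qed
  have "direct_factor K G" unfolding direct_factor_def using nK nI int prod by blast
  moreover have "comm_group (G\<lparr>carrier := K\<rparr>)"
  proof (rule group.group_comm_groupI)
    show "group (G\<lparr>carrier := K\<rparr>)" using nK normal_imp_subgroup subgroup_imp_group by blast
    fix y w assume "y \<in> carrier (G\<lparr>carrier := K\<rparr>)" "w \<in> carrier (G\<lparr>carrier := K\<rparr>)"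
    then show "y \<otimes>\<^bsub>G\<lparr>carrier := K\<rparr>\<^esub> w = w \<otimes>\<^bsub>G\<lparr>carrier := K\<rparr>\<^esub> y"
      using center_commute[of y w] center_closed[of w] Kc by auto
  qed
  ultimately have "K = {\<one>}" using pn unfolding purely_nonabelian_def by blast
  then show ?thesis using x by (auto simp: K_def kernel_def)
qed

text \<open>Pure non-abelianity enters here: it makes \<open>x \<mapsto> x \<otimes> f x\<close> an automorphism for \<^emph>\<open>every\<close>
homomorphism \<open>f\<close> to the centre.\<close>
theorem central_endomorphism_bij:
  assumes pn: "purely_nonabelian G" and fin: "finite (carrier G)"
    and \<sigma>: "central_endomorphism G \<sigma>"
  shows "bij_betw \<sigma> (carrier G) (carrier G)"
proof -
  have hom: "\<sigma> ^^ n \<in> hom G G" for n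
    using central_endomorphism_funpow[OF \<sigma>] by (simp add: central_endomorphism_def)
  have closed: "(\<sigma> ^^ n) x \<in> carrier G" if "x \<in> carrier G" for n x
    using hom[of n] that by (auto simp: hom_def)
  define I where "I n = (\<sigma> ^^ n) ` carrier G" for n
  have finI: "finite (I n)" for n using fin by (simp add: I_def)
  have I_add: "(\<sigma> ^^ m) ` I n = I (m + n)" for m n
    by (simp add: I_def image_image funpow_add)
  have I_mono: "I (n + m) \<subseteq> I n" for m n
    using closed by (auto simp: I_def funpow_add)
  \<comment> \<open>The images of the iterates decrease; from an image of least size on they are stable. The
    successor of \<open>n\<close> is taken so that \<open>ker \<sigma>\<close> is contained in the kernel of \<open>e\<close>.\<close>
  define n where "n = (ARG_MIN (\<lambda>n. card (I n)) n. True)"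
  have min: "card (I n) \<le> card (I m)" for m
    unfolding n_def by (rule arg_min_nat_le) simp
  define e where "e = \<sigma> ^^ Suc n"
  have "I (Suc n + Suc n) = I (Suc n)"
  proof (rule card_seteq[OF finI I_mono])
    have "card (I (Suc n)) \<le> card (I n)" using I_mono[of n 1] finI by (simp add: card_mono)
    then show "card (I (Suc n)) \<le> card (I (Suc n + Suc n))" using min le_trans by blast
  qed
  then have stable: "e ` e ` carrier G = e ` carrier G"
    using I_add[of "Suc n" "Suc n"] by (simp only: I_def e_def)
  have e: "central_endomorphism G e" unfolding e_def by (rule central_endomorphism_funpow[OF \<sigma>])
  have \<sigma>h: "\<sigma> \<in> hom G G" using \<sigma> by (simp add: central_endomorphism_def)
  interpret \<sigma>: group_hom G G \<sigma> using \<sigma>h by (simp add: group_hom_def group_hom_axioms_def)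
  have "x = \<one>" if x: "x \<in> carrier G" "\<sigma> x = \<one>" for x
  proof (rule central_endomorphism_kernel_trivial_if_stable[OF pn fin e stable x(1)])
    have "(\<sigma> ^^ n) \<one> = \<one>" using hom[of n] hom_one is_group by blast
    then show "e x = \<one>" using x by (simp add: e_def funpow_swap1)
  qed
  then have "inj_on \<sigma> (carrier G)" by (intro \<sigma>.inj_on_one_iff[THEN iffD2]) blast
  then show ?thesis
    using fin by (intro bij_betw_imageI endo_inj_surj) auto
qed

lemma central_auto_iff:
  "\<sigma> \<in> central_auto G \<longleftrightarrow>
     central_endomorphism G \<sigma> \<and> \<sigma> \<in> extensional (carrier G) \<and> bij_betw \<sigma> (carrier G) (carrier G)"
  by (auto simp: central_auto_def central_endomorphism_def auto_def Bij_def)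

lemma subgroup_central_auto: "subgroup (central_auto G) (AutoGroup G)"
proof -
  interpret AG: group "AutoGroup G" by (rule AutoGroup)
  interpret BG: group "BijGroup (carrier G)" by (rule group_BijGroup)
  have car: "carrier (AutoGroup G) = auto G" by (simp add: AutoGroup_def)
  have BijI: "\<sigma> \<in> Bij (carrier G)" if "\<sigma> \<in> auto G" for \<sigma> using that by (simp add: auto_def)
  have sub: "central_auto G \<subseteq> auto G" by (auto simp: central_auto_def)
  show ?thesis
  proof (rule AG.subgroupI)
    show "central_auto G \<subseteq> carrier (AutoGroup G)" using sub car by simp
    have "(\<lambda>x\<in>carrier G. x) \<in> central_auto G"
      using id_in_auto subgroup.one_closed[OF center_subgroup] by (simp add: central_auto_def)
    then show "central_auto G \<noteq> {}" by blast
    fix \<sigma> assume \<sigma>: "\<sigma> \<in> central_auto G"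
    have \<sigma>a: "\<sigma> \<in> auto G" using sub \<sigma> by blast
    have bij: "bij_betw \<sigma> (carrier G) (carrier G)" and ce: "central_endomorphism G \<sigma>"
      using \<sigma> by (auto simp: central_auto_iff)
    have inv_eq: "inv\<^bsub>AutoGroup G\<^esub> \<sigma> = restrict (inv_into (carrier G) \<sigma>) (carrier G)"
      using BG.m_inv_consistent[OF subgroup_auto \<sigma>a] inv_BijGroup[OF BijI[OF \<sigma>a]]
      by (simp add: AutoGroup_def)
    have "inv\<^bsub>AutoGroup G\<^esub> \<sigma> \<in> auto G" using AG.inv_closed \<sigma>a car by simp
    moreover have "inv g \<otimes> inv_into (carrier G) \<sigma> g \<in> group_center G" if g: "g \<in> carrier G" for g
    proof -
      define h where "h = inv_into (carrier G) \<sigma> g"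
      have h: "h \<in> carrier G" "\<sigma> h = g"
        using bij g by (auto simp: h_def bij_betw_def inv_into_into f_inv_into_f)
      obtain z where z: "z \<in> group_center G" "\<sigma> h = h \<otimes> z"
        by (rule central_endomorphism_decomp[OF ce h(1)])
      have zG: "z \<in> carrier G" by (rule center_closed[OF z(1)])
      have "inv g \<otimes> h = inv z"
        using h z(2) zG by (metis inv_mult_group inv_solve_right' m_assoc inv_closed l_inv r_one)
      then show ?thesis
        using subgroup.m_inv_closed[OF center_subgroup z(1)] by (simp add: h_def)
    qed
    ultimately show "inv\<^bsub>AutoGroup G\<^esub> \<sigma> \<in> central_auto G"
      by (simp add: central_auto_def inv_eq)
    fix \<tau> assume \<tau>: "\<tau> \<in> central_auto G"
    have \<tau>a: "\<tau> \<in> auto G" using sub \<tau> by blast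
    have eq: "\<sigma> \<otimes>\<^bsub>AutoGroup G\<^esub> \<tau> = compose (carrier G) \<sigma> \<tau>"
      using BijI[OF \<sigma>a] BijI[OF \<tau>a] by (simp add: AutoGroup_def BijGroup_def)
    have "\<sigma> \<otimes>\<^bsub>AutoGroup G\<^esub> \<tau> \<in> auto G" using AG.m_closed \<sigma>a \<tau>a car by simp
    moreover have "central_endomorphism G (\<sigma> \<circ> \<tau>)"
      using \<sigma> \<tau> by (intro central_endomorphism_comp) (auto simp: central_auto_iff)
    ultimately show "\<sigma> \<otimes>\<^bsub>AutoGroup G\<^esub> \<tau> \<in> central_auto G"
      by (simp add: central_auto_def eq central_endomorphism_def compose_def)
  qed
qed

lemma comm_group_CentralAutoGroup_iff:
  "comm_group (CentralAutoGroup G) \<longleftrightarrow>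
     (\<forall>\<sigma>\<in>central_auto G. \<forall>\<tau>\<in>central_auto G. \<forall>x\<in>carrier G. \<sigma> (\<tau> x) = \<tau> (\<sigma> x))"
proof -
  have C: "group (CentralAutoGroup G)"
    unfolding CentralAutoGroup_def
    by (rule group.subgroup_imp_group[OF AutoGroup subgroup_central_auto])
  have car: "carrier (CentralAutoGroup G) = central_auto G" by (simp add: CentralAutoGroup_def)
  have mult: "\<sigma> \<otimes>\<^bsub>CentralAutoGroup G\<^esub> \<tau> = compose (carrier G) \<sigma> \<tau>"
    if "\<sigma> \<in> central_auto G" "\<tau> \<in> central_auto G" for \<sigma> \<tau>
    using that by (simp add: CentralAutoGroup_def AutoGroup_def BijGroup_def central_auto_def auto_def)
  have eq: "compose (carrier G) \<sigma> \<tau> = compose (carrier G) \<tau> \<sigma> \<longleftrightarrow> (\<forall>x\<in>carrier G. \<sigma> (\<tau> x) = \<tau> (\<sigma> x))"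
    for \<sigma> \<tau> :: "'a \<Rightarrow> 'a"
    unfolding compose_def fun_eq_iff restrict_def by auto
  show ?thesis
  proof
    assume "comm_group (CentralAutoGroup G)"
    then interpret CC: comm_group "CentralAutoGroup G" .
    show "\<forall>\<sigma>\<in>central_auto G. \<forall>\<tau>\<in>central_auto G. \<forall>x\<in>carrier G. \<sigma> (\<tau> x) = \<tau> (\<sigma> x)"
    proof (intro ballI)
      fix \<sigma> \<tau> x assume \<sigma>: "\<sigma> \<in> central_auto G" and \<tau>: "\<tau> \<in> central_auto G" and x: "x \<in> carrier G"
      have "compose (carrier G) \<sigma> \<tau> = compose (carrier G) \<tau> \<sigma>"
        using CC.m_comm[of \<sigma> \<tau>] mult \<sigma> \<tau> car by simp
      then show "\<sigma> (\<tau> x) = \<tau> (\<sigma> x)" using x eq by blast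
    qed
  next
    assume *: "\<forall>\<sigma>\<in>central_auto G. \<forall>\<tau>\<in>central_auto G. \<forall>x\<in>carrier G. \<sigma> (\<tau> x) = \<tau> (\<sigma> x)"
    show "comm_group (CentralAutoGroup G)"
    proof (rule group.group_comm_groupI[OF C])
      fix \<sigma> \<tau> assume "\<sigma> \<in> carrier (CentralAutoGroup G)" "\<tau> \<in> carrier (CentralAutoGroup G)"
      then have st: "\<sigma> \<in> central_auto G" "\<tau> \<in> central_auto G" using car by auto
      have "compose (carrier G) \<sigma> \<tau> = compose (carrier G) \<tau> \<sigma>" using * st eq by blast
      then show "\<sigma> \<otimes>\<^bsub>CentralAutoGroup G\<^esub> \<tau> = \<tau> \<otimes>\<^bsub>CentralAutoGroup G\<^esub> \<sigma>"
        using mult st by simp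
    qed
  qed
qed

lemma hom_center_closed:
  assumes "f \<in> hom G (center_group G)" "x \<in> carrier G"
  shows "f x \<in> group_center G" "f x \<in> carrier G"
  using assms center_closed by (auto simp: hom_def)

lemma central_auto_of_hom:
  assumes pn: "purely_nonabelian G" and fin: "finite (carrier G)"
    and f: "f \<in> hom G (center_group G)"
  shows "(\<lambda>x\<in>carrier G. x \<otimes> f x) \<in> central_auto G"
proof -
  let ?\<sigma> = "\<lambda>x\<in>carrier G. x \<otimes> f x"
  note fc = hom_center_closed[OF f]
  have "?\<sigma> \<in> hom G G"
  proof (rule homI)
    fix x y assume x: "x \<in> carrier G" and y: "y \<in> carrier G"
    have "x \<otimes> y \<otimes> (f x \<otimes> f y) = x \<otimes> (y \<otimes> f x) \<otimes> f y"
      using x y fc by (simp add: m_assoc)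
    also have "y \<otimes> f x = f x \<otimes> y" using center_commute[OF fc(1)[OF x] y] by simp
    also have "x \<otimes> (f x \<otimes> y) \<otimes> f y = x \<otimes> f x \<otimes> (y \<otimes> f y)"
      using x y fc by (simp add: m_assoc)
    finally show "?\<sigma> (x \<otimes> y) = ?\<sigma> x \<otimes> ?\<sigma> y"
      using x y f by (simp add: hom_def)
  qed (use fc in simp)
  then have "central_endomorphism G ?\<sigma>"
    by (rule central_endomorphismI) (use fc in auto)
  then show ?thesis
    using central_endomorphism_bij[OF pn fin] restrict_extensional unfolding central_auto_iff by blast
qed

lemma hom_of_central_auto:
  assumes "\<sigma> \<in> central_auto G"
  shows "(\<lambda>x. inv x \<otimes> \<sigma> x) \<in> hom G (center_group G)"
proof -
  have \<sigma>: "central_endomorphism G \<sigma>" using assms by (simp add: central_auto_iff)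
  then have h: "\<sigma> \<in> hom G G" and
    c: "\<And>x. x \<in> carrier G \<Longrightarrow> inv x \<otimes> \<sigma> x \<in> group_center G"
    by (auto simp: central_endomorphism_def)
  have sc: "\<sigma> x \<in> carrier G" if "x \<in> carrier G" for x using h that by (auto simp: hom_def)
  show ?thesis
  proof (rule homI)
    fix x y assume x: "x \<in> carrier G" and y: "y \<in> carrier G"
    have "inv (x \<otimes> y) \<otimes> \<sigma> (x \<otimes> y) = inv y \<otimes> (inv x \<otimes> \<sigma> x) \<otimes> \<sigma> y"
      using x y sc h by (simp add: hom_mult inv_mult_group m_assoc)
    also have "inv y \<otimes> (inv x \<otimes> \<sigma> x) = (inv x \<otimes> \<sigma> x) \<otimes> inv y"
      using center_commute[OF c[OF x], of "inv y"] y by simp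
    finally show "inv (x \<otimes> y) \<otimes> \<sigma> (x \<otimes> y) = (inv x \<otimes> \<sigma> x) \<otimes>\<^bsub>center_group G\<^esub> (inv y \<otimes> \<sigma> y)"
      using x y sc by (simp add: m_assoc)
  qed (use c in simp)
qed

text \<open>With \<open>\<sigma> x = x \<otimes> f x\<close> and \<open>\<tau> x = x \<otimes> g x\<close> one has \<open>\<sigma> (\<tau> x) = x \<otimes> g x \<otimes> f x \<otimes> f (g x)\<close>, where all factors
but \<open>x\<close> are central. Exchanging \<open>\<sigma>\<close> and \<open>\<tau>\<close> only affects the last factor.\<close>
theorem central_autos_commute_iff_homs_commute:
  assumes pn: "purely_nonabelian G" and fin: "finite (carrier G)"
  shows "comm_group (CentralAutoGroup G) \<longleftrightarrow> homs_commute G (center_group G) (\<lambda>x. x)"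
proof -
  have expand: "x \<otimes> g x \<otimes> f (x \<otimes> g x) = x \<otimes> (f x \<otimes> g x) \<otimes> f (g x)"
    if f: "f \<in> hom G (center_group G)" and g: "g \<in> hom G (center_group G)" and x: "x \<in> carrier G"
    for f g x
  proof -
    note fc = hom_center_closed[OF f] and gc = hom_center_closed[OF g]
    have "f (x \<otimes> g x) = f x \<otimes> f (g x)" using f x gc by (simp add: hom_def)
    then show ?thesis
      using x fc gc center_commute[OF gc(1)[OF x], of "f x"] by (simp add: m_assoc flip: m_assoc[of "g x"])
  qed
  have swap: "x \<otimes> g x \<otimes> f (x \<otimes> g x) = x \<otimes> f x \<otimes> g (x \<otimes> f x) \<longleftrightarrow> f (g x) = g (f x)"
    if f: "f \<in> hom G (center_group G)" and g: "g \<in> hom G (center_group G)" and x: "x \<in> carrier G"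
    for f g x
  proof -
    note fc = hom_center_closed[OF f] and gc = hom_center_closed[OF g]
    have "f x \<otimes> g x = g x \<otimes> f x" by (rule center_commute[OF fc(1)[OF x] gc(2)[OF x]])
    then show ?thesis
      unfolding expand[OF f g x] expand[OF g f x] using x fc gc by simp
  qed
  show ?thesis
    unfolding comm_group_CentralAutoGroup_iff homs_commute_def
  proof (intro iffI ballI)
    fix f g x
    assume comm: "\<forall>\<sigma>\<in>central_auto G. \<forall>\<tau>\<in>central_auto G. \<forall>x\<in>carrier G. \<sigma> (\<tau> x) = \<tau> (\<sigma> x)"
      and f: "f \<in> hom G (center_group G)" and g: "g \<in> hom G (center_group G)" and x: "x \<in> carrier G"
    have "(\<lambda>x\<in>carrier G. x \<otimes> f x) ((\<lambda>x\<in>carrier G. x \<otimes> g x) x)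
        = (\<lambda>x\<in>carrier G. x \<otimes> g x) ((\<lambda>x\<in>carrier G. x \<otimes> f x) x)"
      using comm central_auto_of_hom[OF pn fin f] central_auto_of_hom[OF pn fin g] x by blast
    then show "f (g x) = g (f x)"
      using swap[OF f g x] x hom_center_closed[OF f] hom_center_closed[OF g] by simp
  next
    fix \<sigma> \<tau> x
    assume comm: "\<forall>f\<in>hom G (center_group G). \<forall>g\<in>hom G (center_group G). \<forall>x\<in>carrier G. f (g x) = g (f x)"
      and \<sigma>: "\<sigma> \<in> central_auto G" and \<tau>: "\<tau> \<in> central_auto G" and x: "x \<in> carrier G"
    define f where "f x = inv x \<otimes> \<sigma> x" for x
    define g where "g x = inv x \<otimes> \<tau> x" for x
    have f: "f \<in> hom G (center_group G)" and g: "g \<in> hom G (center_group G)"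
      using hom_of_central_auto[OF \<sigma>] hom_of_central_auto[OF \<tau>] by (auto simp: f_def[abs_def] g_def[abs_def])
    have "\<sigma> y \<in> carrier G" "\<tau> y \<in> carrier G" if "y \<in> carrier G" for y
      using \<sigma> \<tau> that by (auto simp: central_auto_iff central_endomorphism_def hom_def)
    then have s: "\<sigma> y = y \<otimes> f y" and t: "\<tau> y = y \<otimes> g y" if "y \<in> carrier G" for y
      using that by (simp_all add: f_def g_def flip: m_assoc)
    have "f (g x) = g (f x)" using comm f g x by blast
    then show "\<sigma> (\<tau> x) = \<tau> (\<sigma> x)"
      using swap[OF f g x] x s t hom_center_closed[OF f] hom_center_closed[OF g] by simp
  qed
qed

lemma hom_center_derived:
  assumes f: "f \<in> hom G (center_group G)" and d: "d \<in> derived G (carrier G)"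
  shows "f d = \<one>"
proof -
  interpret C: comm_group "center_group G" by (rule center_comm_group)
  interpret f: group_hom G "center_group G" f using f by (simp add: group_hom_def group_hom_axioms_def)
  have "f ` derived G (carrier G) = derived (center_group G) (f ` carrier G)"
    by (rule f.derived_img[symmetric]) simp
  also have "\<dots> = {\<one>}"
    using C.derived_eq_singleton[of "f ` carrier G"] f.hom_closed by auto
  finally show ?thesis using d by blast
qed

text \<open>Homomorphisms to the centre kill commutators, hence are those of the abelianisation.\<close>
lemma homs_commute_iff_abelianisation:
  defines "D \<equiv> derived G (carrier G)"
  shows "homs_commute G (center_group G) (\<lambda>x. x) \<longleftrightarrow>
    homs_commute (G Mod D) (center_group G) (\<lambda>x. D #> x)"
proof -
  have nD: "D \<lhd> G" unfolding D_def by (rule derived_self_is_normal)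
  have sD: "subgroup D G" using nD normal_imp_subgroup by blast
  have q: "(\<lambda>x. D #> x) \<in> hom G (G Mod D)" by (rule normal.r_coset_hom_Mod[OF nD])
  show ?thesis
    unfolding homs_commute_def
  proof (intro iffI ballI)
    fix f g Y
    assume comm: "\<forall>f\<in>hom G (center_group G). \<forall>g\<in>hom G (center_group G). \<forall>x\<in>carrier G. f (g x) = g (f x)"
      and f: "f \<in> hom (G Mod D) (center_group G)" and g: "g \<in> hom (G Mod D) (center_group G)"
      and Y: "Y \<in> carrier (G Mod D)"
    obtain x where x: "x \<in> carrier G" "Y = D #> x" using Y by (auto simp: carrier_FactGroup)
    have "(f \<circ> (#>) D) ((g \<circ> (#>) D) x) = (g \<circ> (#>) D) ((f \<circ> (#>) D) x)"
      using comm[THEN bspec, OF Group.hom_compose[OF q f], THEN bspec, OF Group.hom_compose[OF q g]] x(1) by (rule bspec)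
    then show "f (D #> g Y) = g (D #> f Y)" using x by simp
  next
    fix f g x
    assume comm: "\<forall>f\<in>hom (G Mod D) (center_group G). \<forall>g\<in>hom (G Mod D) (center_group G).
       \<forall>Y\<in>carrier (G Mod D). f (D #> g Y) = g (D #> f Y)"
      and f: "f \<in> hom G (center_group G)" and g: "g \<in> hom G (center_group G)" and x: "x \<in> carrier G"
    have factor: "\<exists>h'\<in>hom (G Mod D) (center_group G). \<forall>y\<in>carrier G. h' (D #> y) = h y"
      if h: "h \<in> hom G (center_group G)" for h
    proof -
      have "h y = h w" if y: "y \<in> carrier G" "w \<in> carrier G" "D #> y = D #> w" for y w
      proof -
        have d: "y \<otimes> inv w \<in> D" using rcoset_eq_iff[OF sD y(1,2)] y(3) by simp
        have "y = (y \<otimes> inv w) \<otimes> w" using y by (simp add: m_assoc)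
        moreover have "h ((y \<otimes> inv w) \<otimes> w) = h (y \<otimes> inv w) \<otimes>\<^bsub>center_group G\<^esub> h w"
          using y by (intro hom_mult[OF h]) auto
        ultimately have "h y = h (y \<otimes> inv w) \<otimes> h w" by simp
        then show ?thesis
          using hom_center_derived[OF h d[unfolded D_def]] hom_center_closed(2)[OF h y(2)] by simp
      qed
      from FactGroup_universal[OF h nD this] show ?thesis by metis
    qed
    obtain f' where f': "f' \<in> hom (G Mod D) (center_group G)" "\<And>y. y \<in> carrier G \<Longrightarrow> f' (D #> y) = f y"
      using factor[OF f] by blast
    obtain g' where g': "g' \<in> hom (G Mod D) (center_group G)" "\<And>y. y \<in> carrier G \<Longrightarrow> g' (D #> y) = g y"
      using factor[OF g] by blast
    have "D #> x \<in> carrier (G Mod D)" using x by (auto simp: carrier_FactGroup)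
    then have "f' (D #> g' (D #> x)) = g' (D #> f' (D #> x))" using comm f' g' by blast
    then show "f (g x) = g (f x)"
      using f'(2) g'(2) x hom_center_closed(2)[OF f x] hom_center_closed(2)[OF g x] by simp
  qed
qed

end

section \<open>Exponents and cyclic sections\<close>

lemma ord_restrict_carrier:
  assumes "group G" "group (G\<lparr>carrier := H\<rparr>)"
  shows "group.ord (G\<lparr>carrier := H\<rparr>) x = group.ord G x"
  unfolding group.ord_def[OF assms(1)] group.ord_def[OF assms(2)] by (simp add: nat_pow_def)

text \<open>If no element had order \<open>p ^ e\<close>, the exponent would divide \<open>p ^ (e - 1)\<close>.\<close>
lemma prime_power_exponent:
  fixes p e :: nat
  assumes p: "Factorial_Ring.prime p" and H: "group H" and fin: "finite (carrier H)"
    and e: "p ^ e = group_exponent H"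
  shows "x \<in> carrier H \<Longrightarrow> x [^]\<^bsub>H\<^esub> (p ^ e) = \<one>\<^bsub>H\<^esub>"
    and "\<exists>x\<in>carrier H. group.ord H x = p ^ e"
proof -
  interpret group H by (rule H)
  let ?E = "\<lambda>n. n > 0 \<and> (\<forall>x\<in>carrier H. x [^]\<^bsub>H\<^esub> n = \<one>\<^bsub>H\<^esub>)"
  have "?E (order H)" using fin order_gt_0_iff_finite pow_order_eq_1 by auto
  then have E: "?E (p ^ e)" unfolding e group_exponent_def by (rule LeastI)
  then show "x \<in> carrier H \<Longrightarrow> x [^]\<^bsub>H\<^esub> (p ^ e) = \<one>\<^bsub>H\<^esub>" by blast
  have min: "p ^ e \<le> n" if "?E n" for n
    unfolding e group_exponent_def by (rule Least_le) (rule that)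
  show "\<exists>x\<in>carrier H. ord x = p ^ e"
  proof (rule ccontr)
    assume none: "\<not> (\<exists>x\<in>carrier H. ord x = p ^ e)"
    then have "e \<noteq> 0" using ord_id one_closed by (metis power_0)
    then obtain d where d: "e = Suc d" by (cases e) auto
    have "x [^]\<^bsub>H\<^esub> (p ^ d) = \<one>\<^bsub>H\<^esub>" if x: "x \<in> carrier H" for x
    proof -
      have "ord x dvd p ^ e" using E x pow_eq_id by blast
      then obtain j where j: "j \<le> e" "ord x = p ^ j" using p by (auto simp: divides_primepow_nat)
      then have "j \<le> d" using none x d by (cases "j = e") auto
      then show ?thesis using x j pow_eq_id by (simp add: le_imp_power_dvd)
    qed
    moreover have "1 < p" using p by (rule prime_gt_1_nat)
    ultimately have "p ^ e \<le> p ^ d" by (intro min) auto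
    moreover have "p ^ d < p ^ e" using \<open>1 < p\<close> d by simp
    ultimately show False by simp
  qed
qed

context group
begin

text \<open>On \<open>R\<close>, cosets modulo \<open>group_center G \<inter> D\<close> coincide exactly when those modulo \<open>D\<close> do, because \<open>R\<close> is central.
This moves the cyclicity condition into the quotient by \<open>D\<close>, where \<open>lam\<close> takes its values.\<close>
lemma cyclic_section_iff:
  assumes R: "subgroup R G" "R \<subseteq> group_center G" and D: "D \<lhd> G" and N: "group_center G \<inter> D \<subseteq> R"
  shows "cyclic_group (G\<lparr>carrier := R\<rparr> Mod (group_center G \<inter> D)) \<longleftrightarrow>
    (\<exists>r\<in>R. \<forall>s\<in>R. \<exists>i::int. D #> s = (D #> r) [^]\<^bsub>G Mod D\<^esub> i)"
proof -
  let ?N = "group_center G \<inter> D" and ?R = "G\<lparr>carrier := R\<rparr>"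
  have sD: "subgroup D G" using D normal_imp_subgroup by blast
  have sN: "subgroup ?N G" using subgroups_Inter_pair[OF center_subgroup sD] .
  have RG: "r \<in> carrier G" if "r \<in> R" for r using subgroup.mem_carrier[OF R(1) that] .
  interpret RR: group ?R by (rule subgroup_imp_group[OF R(1)])
  have "comm_group ?R"
    by (rule RR.group_comm_groupI) (use R(2) RG center_commute in auto)
  then interpret RC: comm_group ?R .
  have sNR: "subgroup ?N ?R" using subgroup_incl[OF sN R(1) N] .
  then have nN: "?N \<lhd> ?R" by (rule RC.subgroup_imp_normal)
  interpret N: normal ?N ?R by (rule nN)
  interpret D: normal D G by (rule D)
  interpret Q: group "?R Mod ?N" by (rule N.factorgroup_is_group)
  have coset: "?N #>\<^bsub>?R\<^esub> x = ?N #> x" for x by (simp add: r_coset_def)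
  have pow: "r [^]\<^bsub>?R\<^esub> i = r [^] i" if "r \<in> R" for r and i :: int
    using int_pow_consistent[OF R(1) that] by simp
  have pR: "r [^] (i::int) \<in> R" if "r \<in> R" for r i using subgroup_int_pow_closed[OF R(1) that] .
  have eq: "?N #> s = ?N #> r \<longleftrightarrow> D #> s = D #> r" if "s \<in> R" "r \<in> R" for s r
  proof -
    have "s \<otimes> inv r \<in> R" using R(1) that by (simp add: subgroup.m_closed subgroup.m_inv_closed)
    then have "s \<otimes> inv r \<in> group_center G" using R(2) by blast
    then show ?thesis using rcoset_eq_iff[OF sN] rcoset_eq_iff[OF sD] RG that by simp
  qed
  have car: "carrier (?R Mod ?N) = (\<lambda>s. ?N #> s) ` R"
    using coset by (simp add: carrier_FactGroup)
  have powN: "(?N #> r) [^]\<^bsub>?R Mod ?N\<^esub> i = ?N #> r [^] i" if "r \<in> R" for r and i :: int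
    using N.FactGroup_int_pow[of r i] coset pow[OF that] that by simp
  have powD: "(D #> r) [^]\<^bsub>G Mod D\<^esub> i = D #> r [^] i" if "r \<in> R" for r and i :: int
    using D.FactGroup_int_pow[OF RG[OF that]] by simp
  have "cyclic_group (?R Mod ?N) \<longleftrightarrow>
      (\<exists>r\<in>R. (\<lambda>s. ?N #> s) ` R = range (\<lambda>i::int. ?N #> r [^] i))"
    unfolding Q.cyclic_group car by (simp add: powN)
  also have "\<dots> \<longleftrightarrow> (\<exists>r\<in>R. \<forall>s\<in>R. \<exists>i::int. ?N #> s = ?N #> r [^] i)"
  proof -
    have "(\<lambda>s. ?N #> s) ` R = range (\<lambda>i::int. ?N #> r [^] i) \<longleftrightarrow>
        (\<forall>s\<in>R. \<exists>i::int. ?N #> s = ?N #> r [^] i)" (is "?A = ?B \<longleftrightarrow> ?P") if "r \<in> R" for r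
    proof
      assume AB: "?A = ?B"
      show ?P
      proof
        fix s assume "s \<in> R"
        then have "?N #> s \<in> ?B" using AB by (metis imageI)
        then show "\<exists>i::int. ?N #> s = ?N #> r [^] i" by (simp add: image_iff)
      qed
    next
      assume ?P
      then have "?A \<subseteq> ?B" by (simp add: image_subset_iff image_iff)
      moreover have "?B \<subseteq> ?A" using pR[OF that] by (simp add: image_subset_iff)
      ultimately show "?A = ?B" by (rule subset_antisym)
    qed
    then show ?thesis by simp
  qed
  also have "\<dots> \<longleftrightarrow> (\<exists>r\<in>R. \<forall>s\<in>R. \<exists>i::int. D #> s = (D #> r) [^]\<^bsub>G Mod D\<^esub> i)"
    using eq pR powD by simp
  finally show ?thesis .
qed

end

section \<open>When central automorphisms commute\<close>

theorem theorem4p1: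
  fixes G :: "('a, 'm) monoid_scheme" (structure)
    and p b n1 c :: nat
    and Z G' R :: "'a set"
    and lam :: "'a \<Rightarrow> 'a set"
  assumes "Factorial_Ring.prime p"
    and "group G"
    and "finite (carrier G)"
    and "\<exists>n. order G = p ^ n"
    and "purely_nonabelian G"
    and "Z = group_center G"
    and "G' = derived G (carrier G)"
    and "lam = (\<lambda>x. G' #> x)"
    and "p ^ b = group_exponent (G Mod G')"
    and "R = {x \<in> Z. group.ord G x \<le> p ^ b}"
    and "p ^ n1 = group_exponent (G\<lparr>carrier := R\<rparr>)"
    and "p ^ c = group_exponent (G\<lparr>carrier := Z \<inter> G'\<rparr>)"
  shows "comm_group (CentralAutoGroup G) \<longleftrightarrow>
     lam ` R \<subseteq> nth_powers (G Mod G') (p ^ n1) \<or>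
     (\<exists>k. c \<le> k \<and> k < n1 \<and> lam ` R = nth_powers (G Mod G') (p ^ k) \<and>
          cyclic_group ((G\<lparr>carrier := R\<rparr>) Mod (Z \<inter> G')))"
proof -
  interpret group G by (rule assms(2))
  note p = assms(1) and fin = assms(3) and pn = assms(5) and Z = assms(6) and G' = assms(7)
    and lam = assms(8) and b = assms(9) and R = assms(10) and n1 = assms(11) and c = assms(12)
  have p1: "p > 1" using p by (rule prime_gt_1_nat)
  have nD: "G' \<lhd> G" unfolding G' by (rule derived_self_is_normal)
  have sD: "subgroup G' G" using nD normal_imp_subgroup by blast
  interpret D: normal G' G by (rule nD)
  interpret A: comm_group "G Mod G'" unfolding G' by (rule derived_quot_is_comm_group)
  interpret C: comm_group "center_group G" by (rule center_comm_group)
  have ZG: "x \<in> carrier G" if "x \<in> Z" for x using that Z center_closed by simp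
  have R_eq: "R = {r \<in> Z. r [^] (p ^ b) = \<one>}"
  proof -
    have "ord x \<le> p ^ b \<longleftrightarrow> x [^] (p ^ b) = \<one>" if x: "x \<in> Z" for x
    proof -
      obtain n where "order G = p ^ n" using assms(4) by blast
      then have "ord x dvd p ^ n" using ord_dvd_group_order[OF ZG[OF x]] by simp
      then obtain j where j: "ord x = p ^ j" using p by (auto simp: divides_primepow_nat)
      then show ?thesis
        using p1 ZG[OF x] by (simp add: pow_eq_id dvd_power_iff_le)
    qed
    then show ?thesis unfolding R by blast
  qed
  have finA: "finite (carrier (G Mod G'))" using fin by (simp add: carrier_FactGroup)
  have lamhom: "lam \<in> hom (center_group G) (G Mod G')"
    using D.r_coset_hom_Mod center_closed unfolding lam by (auto simp: hom_def)
  interpret lam: group_hom "center_group G" "G Mod G'" lam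
    using lamhom by (simp add: group_hom_def group_hom_axioms_def)
  have RC: "R = {r \<in> carrier (center_group G). r [^]\<^bsub>center_group G\<^esub> (p ^ b) = \<one>\<^bsub>center_group G\<^esub>}"
    unfolding R_eq Z by (simp flip: nat_pow_consistent)
  have sR: "subgroup R G"
  proof -
    have "subgroup R (center_group G)"
      unfolding RC by (rule C.subgroup_bounded_exponent)
    then show ?thesis using incl_subgroup[OF center_subgroup] by blast
  qed
  have gR: "group (G\<lparr>carrier := R\<rparr>)" by (rule subgroup_imp_group[OF sR])
  have sN: "subgroup (Z \<inter> G') G" unfolding Z using subgroups_Inter_pair[OF center_subgroup sD] .
  have gN: "group (G\<lparr>carrier := Z \<inter> G'\<rparr>)" by (rule subgroup_imp_group[OF sN])
  have kernel: "lam u = G' \<longleftrightarrow> u \<in> G'" if "u \<in> carrier G" for u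
    unfolding lam using sD that coset_join1[OF _ that sD] coset_join2[OF that sD] subgroup.subset by blast
  have finR: "finite (carrier (G\<lparr>carrier := R\<rparr>))" and finN: "finite (carrier (G\<lparr>carrier := Z \<inter> G'\<rparr>))"
    using fin subgroup.subset[OF sR] subgroup.subset[OF sN] finite_subset by auto
  note expA = prime_power_exponent[OF p A.is_group finA b]
  note expR = prime_power_exponent[OF p gR finR n1]
  note expN = prime_power_exponent[OF p gN finN c]
  interpret CP: central_pairing "G Mod G'" "center_group G" lam p b n1 c R
  proof
    show "Factorial_Ring.prime p" "finite (carrier (G Mod G'))" by fact+
    show "\<And>x. x \<in> carrier (G Mod G') \<Longrightarrow> x [^]\<^bsub>G Mod G'\<^esub> (p ^ b) = \<one>\<^bsub>G Mod G'\<^esub>"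
      and "\<exists>\<alpha>\<in>carrier (G Mod G'). A.ord \<alpha> = p ^ b"
      using expA by auto
    show "R = {r \<in> carrier (center_group G). r [^]\<^bsub>center_group G\<^esub> (p ^ b) = \<one>\<^bsub>center_group G\<^esub>}"
      by (rule RC)
    show "r [^]\<^bsub>center_group G\<^esub> (p ^ n1) = \<one>\<^bsub>center_group G\<^esub>" if "r \<in> R" for r
      using expR(1)[of r] that by (simp flip: nat_pow_consistent)
    show "\<exists>z\<in>R. C.ord z = p ^ n1"
      using expR(2) ord_restrict_carrier[OF is_group gR] ord_restrict_carrier[OF is_group C.is_group]
      by simp
    show "u [^]\<^bsub>center_group G\<^esub> (p ^ c) = \<one>\<^bsub>center_group G\<^esub>"
      if "u \<in> carrier (center_group G)" "lam u = \<one>\<^bsub>G Mod G'\<^esub>" for u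
      using expN(1)[of u] that kernel[of u] ZG[of u] by (simp add: Z flip: nat_pow_consistent)
    show "\<exists>u\<in>carrier (center_group G). lam u = \<one>\<^bsub>G Mod G'\<^esub> \<and> C.ord u = p ^ c"
      using expN(2) ord_restrict_carrier[OF is_group gN] ord_restrict_carrier[OF is_group C.is_group]
        kernel ZG by (auto simp: Z)
  qed
  have comm: "comm_group (CentralAutoGroup G) \<longleftrightarrow>
      homs_commute (G Mod G') (center_group G) lam"
    unfolding central_autos_commute_iff_homs_commute[OF pn fin]
      homs_commute_iff_abelianisation lam G' ..
  have cyclic: "cyclic_group ((G\<lparr>carrier := R\<rparr>) Mod (Z \<inter> G')) \<longleftrightarrow>
      (\<exists>r\<in>R. \<forall>s\<in>R. \<exists>i::int. lam s = lam r [^]\<^bsub>G Mod G'\<^esub> i)" if ck: "c \<le> k" "k < n1" for k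
    unfolding Z lam
  proof (rule cyclic_section_iff[OF sR _ nD])
    show "R \<subseteq> group_center G" unfolding R_eq Z by blast
    obtain z where z: "z \<in> R" "ord z = p ^ n1"
      using expR(2) ord_restrict_carrier[OF is_group gR] by auto
    then have "p ^ n1 dvd p ^ b"
      using pow_eq_id[of z "p ^ b"] ZG[of z] by (simp add: R_eq)
    then have cb: "c \<le> b" using ck p1 by (simp add: dvd_power_iff_le)
    show "group_center G \<inter> G' \<subseteq> R"
    proof
      fix u assume u: "u \<in> group_center G \<inter> G'"
      have uG: "u \<in> carrier G" using u center_closed by blast
      have "u [^] (p ^ c) = \<one>" using expN(1)[of u] u by (simp add: Z flip: nat_pow_consistent)
      then have "ord u dvd p ^ b"
        using pow_eq_id[OF uG] cb by (meson dvd_trans le_imp_power_dvd)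
      then show "u \<in> R" using u pow_eq_id[OF uG] by (simp add: R_eq Z)
    qed
  qed
  show ?thesis
  proof
    assume "comm_group (CentralAutoGroup G)"
    then have "homs_commute (G Mod G') (center_group G) lam" using comm by blast
    from CP.homs_commute_imp[OF this] show "lam ` R \<subseteq> nth_powers (G Mod G') (p ^ n1) \<or>
     (\<exists>k. c \<le> k \<and> k < n1 \<and> lam ` R = nth_powers (G Mod G') (p ^ k) \<and>
          cyclic_group ((G\<lparr>carrier := R\<rparr>) Mod (Z \<inter> G')))"
      using cyclic by blast
  next
    assume "lam ` R \<subseteq> nth_powers (G Mod G') (p ^ n1) \<or>
     (\<exists>k. c \<le> k \<and> k < n1 \<and> lam ` R = nth_powers (G Mod G') (p ^ k) \<and>
          cyclic_group ((G\<lparr>carrier := R\<rparr>) Mod (Z \<inter> G')))"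
    then have "homs_commute (G Mod G') (center_group G) lam"
    proof
      assume "lam ` R \<subseteq> nth_powers (G Mod G') (p ^ n1)"
      then show ?thesis by (rule CP.homs_commute_if_high_powers)
    next
      assume "\<exists>k. c \<le> k \<and> k < n1 \<and> lam ` R = nth_powers (G Mod G') (p ^ k) \<and>
          cyclic_group ((G\<lparr>carrier := R\<rparr>) Mod (Z \<inter> G'))"
      then obtain k where k: "c \<le> k" "k < n1" "lam ` R = nth_powers (G Mod G') (p ^ k)"
        "cyclic_group ((G\<lparr>carrier := R\<rparr>) Mod (Z \<inter> G'))" by blast
      then obtain r where r: "r \<in> R" "\<And>s. s \<in> R \<Longrightarrow> \<exists>i::int. lam s = lam r [^]\<^bsub>G Mod G'\<^esub> i"
        using cyclic[OF k(1,2)] by blast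
      show ?thesis by (rule CP.homs_commute_if_cyclic[OF k(1,3) r])
    qed
    then show "comm_group (CentralAutoGroup G)" using comm by blast
  qed
qed

end
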